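(* Let $\mathcal{C}$ be the strict monoidal supercategory generated by $H,A,U$ subject to the defining relations listed in the context, for some values of the parameters. Consider a diagram composed of an arbitrary number of fundamental diagrams in $\mathcal{C}$, representing a morphism $m\to n$. Then simplifying this diagram using the defining relations of $\mathcal{C}$ ends, after finitely many steps, in a linear combination of standard expressions of $(m,n)$-Brauer diagrams.
   Context: $\mathbb{K}$ is a field of characteristic different from 2; everything is $\mathbb{K}$-linear. A strict monoidal supercategory is a strict monoidal category enriched over $\mathbb{Z}/2$-graded vector spaces, with interchange law $(f\otimes g)\circ(h\otimes k)=(-1)^{|g||h|}(f\circ h)\otimes(g\circ k)$. $\mathcal{C}$ has one generating object $\bullet$; $m\in\mathbb{N}$ denotes $\bullet^{\otimes m}$, $1_m$ its identity, $I=1_1$. Generating morphisms: $H\in\mathrm{Hom}(2,2)$ (over-cross, even), $A\in\mathrm{Hom}(2,0)$ (cap), $U\in\mathrm{Hom}(0,2)$ (cup), with $A,U$ both even or both odd. Defining relations, with parameters $\lambda,\lambda',\varsigma,\varsigma',\delta,\rho,a,b,c,d,e,f,d',e',f',D,E,F,D',E',F'\in\mathbb{K}$: untwisting $HU=\lambda U$, $AH=\lambda'A$; looping $AU=\delta$; straightening $(A\otimes I)(I\otimes U)=\varsigma I$, $(I\otimes A)(U\otimes I)=\varsigma' I$; delooping $(A\otimes I)(I\otimes H)(U\otimes I)=\rho I$; twisting $H^2=a1_2+bH+cUA$; sliding $(H\otimes I)(I\otimes U)=d\,(U\otimes I)+e\,(I\otimes H)(U\otimes I)+f\,(I\otimes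 U)$; pulling $(H\otimes I)(I\otimes H)(U\otimes I)=D\,(U\otimes I)+E\,(I\otimes H)(U\otimes I)+F\,(I\otimes U)$; upside-down sliding $(I\otimes A)(H\otimes I)=d'(A\otimes I)+e'(A\otimes I)(I\otimes H)+f'(I\otimes A)$; upside-down pulling $(A\otimes I)(I\otimes H)(H\otimes I)=D'(A\otimes I)+E'(A\otimes I)(I\otimes H)+F'(I\otimes A)$; braiding $(H\otimes I)(I\otimes H)(H\otimes I)=(I\otimes H)(H\otimes I)(I\otimes H)$. Simplifying means applying these relations locally inside diagrams (left-hand side replaced by right-hand side; the braid relation is used to bring products of crossings to the chosen words in $H(r)$ below), together with the super interchange law. Fundamental diagrams: $s_i^n=1_{i-1}\otimes H\otimes 1_{n-i-1}$, $u_i^n=1_{i-1}\otimes U\otimes 1_{n-i+1}\in\mathrm{Hom}(n,n+2)$, $\mathsf{a}_i^n=1_{i-1}\otimes A\otimes 1_{n-i+1}\in\mathrm{Hom}(n+2,n)$. Standard expressions: for $p\ge1$, $s\ge0$, $p+s\le n+1$ put $I_s^{n,p}=s_{p+s}^{n+2}\cdots s_{p+1}^{n+2}u_p^n$ and $J_s^{n,p}=\mathsf{a}_p^ns_{p+1}^{n+2}\cdots s_{p+s}^{n+2}$. For $n-r=2k\ge0$ let $I(r,n)$ be the set of products $I_{s_1}^{n-2,p_1}I_{s_2}^{n-4,p_2}\cdots I_{s_k}^{r,p_k}$ with $p_1>\dots>p_k$, and $J(n,r)$ the set of products $J_{s_1}^{r,p_1}J_{s_2}^{r+2,p_2}\cdots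 J_{s_k}^{n-2,p_k}$ with $p_1<\dots<p_k$. Let $H(r)$ be a fixed set of words in $s_1^r,\dots,s_{r-1}^r$ with exactly one reduced expression for each element of the symmetric group $S_r$, none containing a consecutive subword $s_is_{i+1}s_i$. The standard expressions of $(m,n)$-Brauer diagrams (perfect matchings of $m$ bottom and $n$ top dots) are the products $UXA$ with $U\in I(r,n)$, $X\in H(r)$, $A\in J(m,r)$, $r\ge 0$; there is exactly one for each Brauer diagram. *)

theory Defs
  imports
    Complex_Main
    "HOL-Library.Sublist"
    "HOL-Combinatorics.Permutations"
begin

section \<open>Parameters, generators, diagrams\<close>

record 'k params =
  lam :: 'k
  lam' :: 'k
  vsigma :: 'k
  vsigma' :: 'k
  delta :: 'k
  rho :: 'k
  pa :: 'k
  pb :: 'k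
  pc :: 'k
  pd :: 'k
  pe :: 'k
  pf :: 'k
  pd' :: 'k
  pe' :: 'k
  pf' :: 'k
  pD :: 'k
  pE :: 'k
  pF :: 'k
  pD' :: 'k
  pE' :: 'k
  pF' :: 'k
  odd_cupcap :: bool  \<comment> \<open>cup and cap are both odd (True) or both even (False)\<close>

text \<open>The generators \<open>H : 2 \<rightarrow> 2\<close>, \<open>A : 2 \<rightarrow> 0\<close>, \<open>U : 0 \<rightarrow> 2\<close>.\<close>

datatype gen = Cross | Cap | Cup

fun gdom :: "gen \<Rightarrow> nat" where
  "gdom Cross = 2" | "gdom Cap = 2" | "gdom Cup = 0"

fun gcod :: "gen \<Rightarrow> nat" where
  "gcod Cross = 2" | "gcod Cap = 0" | "gcod Cup = 2"

fun godd :: "'k params \<Rightarrow> gen \<Rightarrow> bool" where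
  "godd P Cross = False" | "godd P Cap = odd_cupcap P" | "godd P Cup = odd_cupcap P"

definition koszul :: "bool \<Rightarrow> bool \<Rightarrow> 'k::field" where
  "koszul p q = (if p \<and> q then - 1 else 1)"

text \<open>\<open>Layer l g r\<close> is the fundamental diagram \<open>1\<^sub>l \<otimes> g \<otimes> 1\<^sub>r\<close>.\<close>

datatype layer = Layer nat gen nat

fun ldom :: "layer \<Rightarrow> nat" where "ldom (Layer l g r) = l + gdom g + r"
fun lcod :: "layer \<Rightarrow> nat" where "lcod (Layer l g r) = l + gcod g + r"

text \<open>A word \<open>[x\<^sub>1, \<dots>, x\<^sub>N]\<close> of fundamental diagrams stands for the composite
  \<open>x\<^sub>1 \<circ> \<dots> \<circ> x\<^sub>N\<close>, so that its last letter is applied first.\<close>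

fun is_diagram :: "nat \<Rightarrow> nat \<Rightarrow> layer list \<Rightarrow> bool" where
  "is_diagram m n [] \<longleftrightarrow> m = n"
| "is_diagram m n (x # w) \<longleftrightarrow> lcod x = n \<and> is_diagram m (ldom x) w"

text \<open>A formal linear combination of diagrams is a list of pairs (coefficient, diagram);
  repetitions and zero coefficients are allowed.\<close>

type_synonym 'k lincomb = "('k \<times> layer list) list"

text \<open>The defining relations, left-hand side and right-hand side; the first two indices are the
  source and the target.\<close>

inductive defrel :: "'k::field params \<Rightarrow> nat \<Rightarrow> nat \<Rightarrow> layer list \<Rightarrow> 'k lincomb \<Rightarrow> bool"
  for P where
  untwist: "defrel P 0 2 [Layer 0 Cross 0, Layer 0 Cup 0] [(lam P, [Layer 0 Cup 0])]"
| untwist': "defrel P 2 0 [Layer 0 Cap 0, Layer 0 Cross 0] [(lam' P, [Layer 0 Cap 0])]"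
| loop: "defrel P 0 0 [Layer 0 Cap 0, Layer 0 Cup 0] [(delta P, [])]"
| straighten: "defrel P 1 1 [Layer 0 Cap 1, Layer 1 Cup 0] [(vsigma P, [])]"
| straighten': "defrel P 1 1 [Layer 1 Cap 0, Layer 0 Cup 1] [(vsigma' P, [])]"
| deloop: "defrel P 1 1 [Layer 0 Cap 1, Layer 1 Cross 0, Layer 0 Cup 1] [(rho P, [])]"
| twist: "defrel P 2 2 [Layer 0 Cross 0, Layer 0 Cross 0]
    [(pa P, []), (pb P, [Layer 0 Cross 0]), (pc P, [Layer 0 Cup 0, Layer 0 Cap 0])]"
| slide: "defrel P 1 3 [Layer 0 Cross 1, Layer 1 Cup 0]
    [(pd P, [Layer 0 Cup 1]), (pe P, [Layer 1 Cross 0, Layer 0 Cup 1]), (pf P, [Layer 1 Cup 0])]"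
| pull: "defrel P 1 3 [Layer 0 Cross 1, Layer 1 Cross 0, Layer 0 Cup 1]
    [(pD P, [Layer 0 Cup 1]), (pE P, [Layer 1 Cross 0, Layer 0 Cup 1]), (pF P, [Layer 1 Cup 0])]"
| slide': "defrel P 3 1 [Layer 1 Cap 0, Layer 0 Cross 1]
    [(pd' P, [Layer 0 Cap 1]), (pe' P, [Layer 0 Cap 1, Layer 1 Cross 0]), (pf' P, [Layer 1 Cap 0])]"
| pull': "defrel P 3 1 [Layer 0 Cap 1, Layer 1 Cross 0, Layer 0 Cross 1]
    [(pD' P, [Layer 0 Cap 1]), (pE' P, [Layer 0 Cap 1, Layer 1 Cross 0]), (pF' P, [Layer 1 Cap 0])]"
| braid: "defrel P 3 3 [Layer 0 Cross 1, Layer 1 Cross 0, Layer 0 Cross 1]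
    [(1, [Layer 1 Cross 0, Layer 0 Cross 1, Layer 1 Cross 0])]"


section \<open>The supercategory presented by the relations\<close>

text \<open>Morphism expressions of the strict monoidal supercategory with one generating object;
  \<open>Comp f g\<close> is \<open>f \<circ> g\<close>.\<close>

datatype 'k mor =
    Id nat
  | Gen gen
  | Comp "'k mor" "'k mor" (infixr \<open>\<odot>\<close> 75)
  | Tens "'k mor" "'k mor" (infixr \<open>\<boxtimes>\<close> 80)
  | Zero nat nat
  | Add "'k mor" "'k mor" (infixl \<open>\<boxplus>\<close> 65)
  | Scale 'k "'k mor"

inductive arr :: "'k mor \<Rightarrow> nat \<Rightarrow> nat \<Rightarrow> bool" where
  "arr (Id n) n n"
| "arr (Gen g) (gdom g) (gcod g)"
| "arr f n k \<Longrightarrow> arr g m n \<Longrightarrow> arr (f \<odot> g) m k"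
| "arr f m n \<Longrightarrow> arr g m' n' \<Longrightarrow> arr (f \<boxtimes> g) (m + m') (n + n')"
| "arr (Zero m n) m n"
| "arr f m n \<Longrightarrow> arr g m n \<Longrightarrow> arr (f \<boxplus> g) m n"
| "arr f m n \<Longrightarrow> arr (Scale c f) m n"

text \<open>\<open>homog P f p\<close>: the expression \<open>f\<close> is homogeneous, odd if \<open>p\<close> and even otherwise.\<close>

inductive homog :: "'k params \<Rightarrow> 'k mor \<Rightarrow> bool \<Rightarrow> bool" for P where
  "homog P (Id n) False"
| "homog P (Gen g) (godd P g)"
| "homog P f p \<Longrightarrow> homog P g q \<Longrightarrow> homog P (f \<odot> g) (p \<noteq> q)"
| "homog P f p \<Longrightarrow> homog P g q \<Longrightarrow> homog P (f \<boxtimes> g) (p \<noteq> q)"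
| "homog P (Zero m n) p"
| "homog P f p \<Longrightarrow> homog P g p \<Longrightarrow> homog P (f \<boxplus> g) p"
| "homog P f p \<Longrightarrow> homog P (Scale c f) p"

fun layer_mor :: "layer \<Rightarrow> 'k mor" where
  "layer_mor (Layer l g r) = Id l \<boxtimes> Gen g \<boxtimes> Id r"

fun diagram_mor :: "nat \<Rightarrow> layer list \<Rightarrow> 'k mor" where
  "diagram_mor m [] = Id m"
| "diagram_mor m (x # w) = layer_mor x \<odot> diagram_mor m w"

fun lincomb_mor :: "nat \<Rightarrow> nat \<Rightarrow> 'k lincomb \<Rightarrow> 'k mor" where
  "lincomb_mor m n [] = Zero m n"
| "lincomb_mor m n ((c, w) # L) = Scale c (diagram_mor m w) \<boxplus> lincomb_mor m n L"

text \<open>Equality of morphisms \<open>m \<rightarrow> n\<close> in the generated supercategory: the smallest congruence on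
  well-typed expressions containing the laws of a \<open>\<K>\<close>-linear strict monoidal supercategory and
  the defining relations.\<close>

inductive eq_in_C :: "'k::field params \<Rightarrow> nat \<Rightarrow> nat \<Rightarrow> 'k mor \<Rightarrow> 'k mor \<Rightarrow> bool"
  for P where
  refl: "arr f m n \<Longrightarrow> eq_in_C P m n f f"
| sym: "eq_in_C P m n f g \<Longrightarrow> eq_in_C P m n g f"
| trans: "eq_in_C P m n f g \<Longrightarrow> eq_in_C P m n g h \<Longrightarrow> eq_in_C P m n f h"
| comp_cong: "eq_in_C P n k f f' \<Longrightarrow> eq_in_C P m n g g' \<Longrightarrow> eq_in_C P m k (f \<odot> g) (f' \<odot> g')"
| tens_cong: "eq_in_C P m n f f' \<Longrightarrow> eq_in_C P m' n' g g' \<Longrightarrow>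
    eq_in_C P (m + m') (n + n') (f \<boxtimes> g) (f' \<boxtimes> g')"
| add_cong: "eq_in_C P m n f f' \<Longrightarrow> eq_in_C P m n g g' \<Longrightarrow>
    eq_in_C P m n (f \<boxplus> g) (f' \<boxplus> g')"
| scale_cong: "eq_in_C P m n f f' \<Longrightarrow> eq_in_C P m n (Scale c f) (Scale c f')"

| add_assoc: "arr f m n \<Longrightarrow> arr g m n \<Longrightarrow> arr h m n \<Longrightarrow>
    eq_in_C P m n ((f \<boxplus> g) \<boxplus> h) (f \<boxplus> (g \<boxplus> h))"
| add_comm: "arr f m n \<Longrightarrow> arr g m n \<Longrightarrow> eq_in_C P m n (f \<boxplus> g) (g \<boxplus> f)"
| add_zero: "arr f m n \<Longrightarrow> eq_in_C P m n (f \<boxplus> Zero m n) f"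
| scale_0: "arr f m n \<Longrightarrow> eq_in_C P m n (Scale 0 f) (Zero m n)"
| scale_1: "arr f m n \<Longrightarrow> eq_in_C P m n (Scale 1 f) f"
| scale_scale: "arr f m n \<Longrightarrow> eq_in_C P m n (Scale c (Scale c' f)) (Scale (c * c') f)"
| scale_add: "arr f m n \<Longrightarrow> arr g m n \<Longrightarrow>
    eq_in_C P m n (Scale c (f \<boxplus> g)) (Scale c f \<boxplus> Scale c g)"
| add_scale: "arr f m n \<Longrightarrow> eq_in_C P m n (Scale (c + c') f) (Scale c f \<boxplus> Scale c' f)"

| comp_assoc: "arr f k l \<Longrightarrow> arr g n k \<Longrightarrow> arr h m n \<Longrightarrow>
    eq_in_C P m l ((f \<odot> g) \<odot> h) (f \<odot> (g \<odot> h))"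
| id_comp: "arr f m n \<Longrightarrow> eq_in_C P m n (Id n \<odot> f) f"
| comp_id: "arr f m n \<Longrightarrow> eq_in_C P m n (f \<odot> Id m) f"
| add_comp: "arr f n k \<Longrightarrow> arr f' n k \<Longrightarrow> arr g m n \<Longrightarrow>
    eq_in_C P m k ((f \<boxplus> f') \<odot> g) (f \<odot> g \<boxplus> f' \<odot> g)"
| comp_add: "arr f n k \<Longrightarrow> arr g m n \<Longrightarrow> arr g' m n \<Longrightarrow>
    eq_in_C P m k (f \<odot> (g \<boxplus> g')) (f \<odot> g \<boxplus> f \<odot> g')"
| scale_comp: "arr f n k \<Longrightarrow> arr g m n \<Longrightarrow>
    eq_in_C P m k (Scale c f \<odot> g) (Scale c (f \<odot> g))"
| comp_scale: "arr f n k \<Longrightarrow> arr g m n \<Longrightarrow>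
    eq_in_C P m k (f \<odot> Scale c g) (Scale c (f \<odot> g))"

| tens_assoc: "arr f m n \<Longrightarrow> arr g m' n' \<Longrightarrow> arr h m'' n'' \<Longrightarrow>
    eq_in_C P (m + m' + m'') (n + n' + n'') ((f \<boxtimes> g) \<boxtimes> h) (f \<boxtimes> (g \<boxtimes> h))"
| unit_tens: "arr f m n \<Longrightarrow> eq_in_C P m n (Id 0 \<boxtimes> f) f"
| tens_unit: "arr f m n \<Longrightarrow> eq_in_C P m n (f \<boxtimes> Id 0) f"
| id_tens_id: "eq_in_C P (m + n) (m + n) (Id m \<boxtimes> Id n) (Id (m + n))"
| add_tens: "arr f m n \<Longrightarrow> arr f' m n \<Longrightarrow> arr g m' n' \<Longrightarrow>
    eq_in_C P (m + m') (n + n') ((f \<boxplus> f') \<boxtimes> g) (f \<boxtimes> g \<boxplus> f' \<boxtimes> g)"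
| tens_add: "arr f m n \<Longrightarrow> arr g m' n' \<Longrightarrow> arr g' m' n' \<Longrightarrow>
    eq_in_C P (m + m') (n + n') (f \<boxtimes> (g \<boxplus> g')) (f \<boxtimes> g \<boxplus> f \<boxtimes> g')"
| scale_tens: "arr f m n \<Longrightarrow> arr g m' n' \<Longrightarrow>
    eq_in_C P (m + m') (n + n') (Scale c f \<boxtimes> g) (Scale c (f \<boxtimes> g))"
| tens_scale: "arr f m n \<Longrightarrow> arr g m' n' \<Longrightarrow>
    eq_in_C P (m + m') (n + n') (f \<boxtimes> Scale c g) (Scale c (f \<boxtimes> g))"
| interchange: "arr f n k \<Longrightarrow> arr g n' k' \<Longrightarrow> arr h m n \<Longrightarrow> arr h' m' n' \<Longrightarrow>
    homog P g p \<Longrightarrow> homog P h q \<Longrightarrow>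
    eq_in_C P (m + m') (k + k') ((f \<boxtimes> g) \<odot> (h \<boxtimes> h'))
      (Scale (koszul p q) ((f \<odot> h) \<boxtimes> (g \<odot> h')))"

| relation: "defrel P m n w R \<Longrightarrow> eq_in_C P m n (diagram_mor m w) (lincomb_mor m n R)"


section \<open>Simplification\<close>

text \<open>\<open>1\<^sub>l \<otimes> w \<otimes> 1\<^sub>r\<close>, letter by letter.\<close>

definition whisker :: "nat \<Rightarrow> nat \<Rightarrow> layer list \<Rightarrow> layer list" where
  "whisker l r w = map (\<lambda>x. case x of Layer i g j \<Rightarrow> Layer (l + i) g (j + r)) w"

text \<open>The defining relations are only used from left to right, apart from the braid relation, which
  (like the interchange law) is used in both directions.  The interchange law for words of
  fundamental diagrams is
  \<open>(g \<otimes> 1\<^sub>k \<otimes> 1) \<circ> (1 \<otimes> 1\<^sub>k \<otimes> h) = (-1)\<^bsup>|g||h|\<^esup> (1 \<otimes> 1\<^sub>k \<otimes> h) \<circ> (g \<otimes> 1\<^sub>k \<otimes> 1)\<close>.\<close>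

inductive local_rule :: "'k::field params \<Rightarrow> layer list \<Rightarrow> 'k lincomb \<Rightarrow> bool" for P where
  relation: "defrel P m n w R \<Longrightarrow> local_rule P w R"
| braid_back: "local_rule P [Layer 1 Cross 0, Layer 0 Cross 1, Layer 1 Cross 0]
    [(1, [Layer 0 Cross 1, Layer 1 Cross 0, Layer 0 Cross 1])]"
| interchange: "local_rule P [Layer 0 g (k + gcod h), Layer (gdom g + k) h 0]
    [(koszul (godd P g) (godd P h), [Layer (gcod g + k) h 0, Layer 0 g (k + gdom h)])]"
| interchange_back: "local_rule P [Layer (gcod g + k) h 0, Layer 0 g (k + gdom h)]
    [(koszul (godd P g) (godd P h), [Layer 0 g (k + gcod h), Layer (gdom g + k) h 0])]"

text \<open>One step rewrites a part of one diagram occurring in a linear combination.\<close>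

inductive simp_step :: "'k::field params \<Rightarrow> 'k lincomb \<Rightarrow> 'k lincomb \<Rightarrow> bool" for P where
  "local_rule P w R \<Longrightarrow>
   simp_step P (L @ (c, x @ whisker l r w @ y) # L')
     (L @ map (\<lambda>(b, v). (c * b, x @ whisker l r v @ y)) R @ L')"

abbreviation simplifies_to :: "'k::field params \<Rightarrow> 'k lincomb \<Rightarrow> 'k lincomb \<Rightarrow> bool" where
  "simplifies_to P \<equiv> (simp_step P)\<^sup>*\<^sup>*"


section \<open>Standard expressions\<close>

definition s_fd :: "nat \<Rightarrow> nat \<Rightarrow> layer" where "s_fd i n = Layer (i - 1) Cross (n - i - 1)"
definition u_fd :: "nat \<Rightarrow> nat \<Rightarrow> layer" where "u_fd i n = Layer (i - 1) Cup (n + 1 - i)"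
definition a_fd :: "nat \<Rightarrow> nat \<Rightarrow> layer" where "a_fd i n = Layer (i - 1) Cap (n + 1 - i)"

text \<open>\<open>I_word s n p\<close> and \<open>J_word s n p\<close> are \<open>I\<^sub>s\<close> and \<open>J\<^sub>s\<close> with upper indices \<open>n, p\<close>.\<close>

definition I_word :: "nat \<Rightarrow> nat \<Rightarrow> nat \<Rightarrow> layer list" where
  "I_word s n p = map (\<lambda>i. s_fd i (n + 2)) (rev [p + 1..<p + s + 1]) @ [u_fd p n]"

definition J_word :: "nat \<Rightarrow> nat \<Rightarrow> nat \<Rightarrow> layer list" where
  "J_word s n p = a_fd p n # map (\<lambda>i. s_fd i (n + 2)) [p + 1..<p + s + 1]"

text \<open>The factors are numbered from \<open>0\<close>: the factor \<open>j\<close> carries \<open>s\<^sub>j\<^sub>+\<^sub>1\<close> and \<open>p\<^sub>j\<^sub>+\<^sub>1\<close> of the usual products starting at \<open>1\<close>.\<close>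

definition I_set :: "nat \<Rightarrow> nat \<Rightarrow> layer list set" where
  "I_set r n = {concat (map (\<lambda>j. I_word (s j) (n - 2 * (j + 1)) (p j)) [0..<k]) | k s p.
     n = r + 2 * k \<and>
     (\<forall>j<k. 1 \<le> p j \<and> p j + s j \<le> n - 2 * (j + 1) + 1) \<and>
     (\<forall>i j. i < j \<and> j < k \<longrightarrow> p j < p i)}"

definition J_set :: "nat \<Rightarrow> nat \<Rightarrow> layer list set" where
  "J_set n r = {concat (map (\<lambda>j. J_word (s j) (r + 2 * j) (p j)) [0..<k]) | k s p.
     n = r + 2 * k \<and>
     (\<forall>j<k. 1 \<le> p j \<and> p j + s j \<le> r + 2 * j + 1) \<and>
     (\<forall>i j. i < j \<and> j < k \<longrightarrow> p i < p j)}"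

text \<open>Words in the simple transpositions of \<open>S\<^sub>r\<close>, acting on \<open>{1..r}\<close>, are lists of indices.\<close>

fun word_perm :: "nat list \<Rightarrow> nat \<Rightarrow> nat" where
  "word_perm [] = id"
| "word_perm (i # w) = transpose i (i + 1) \<circ> word_perm w"

definition is_word :: "nat \<Rightarrow> nat list \<Rightarrow> bool" where
  "is_word r w \<longleftrightarrow> (\<forall>i\<in>set w. 1 \<le> i \<and> i < r)"

definition reduced :: "nat \<Rightarrow> nat list \<Rightarrow> bool" where
  "reduced r w \<longleftrightarrow> is_word r w \<and>
     (\<forall>v. is_word r v \<and> word_perm v = word_perm w \<longrightarrow> length w \<le> length v)"

definition admissible_H :: "(nat \<Rightarrow> nat list set) \<Rightarrow> bool" where
  "admissible_H HH \<longleftrightarrow> (\<forall>r.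
     (\<forall>w\<in>HH r. reduced r w \<and> (\<forall>i. \<not> sublist [i, i + 1, i] w)) \<and>
     (\<forall>\<pi>. \<pi> permutes {1..r} \<longrightarrow> (\<exists>!w. w \<in> HH r \<and> word_perm w = \<pi>)))"

definition standard :: "(nat \<Rightarrow> nat list set) \<Rightarrow> nat \<Rightarrow> nat \<Rightarrow> layer list set" where
  "standard HH m n = {U @ map (\<lambda>i. s_fd i r) X @ A | r U X A.
     U \<in> I_set r n \<and> X \<in> HH r \<and> A \<in> J_set m r}"

end

theory Submission
  imports Defs
begin

text \<open>Counted by the number of letters plus the number of crossings, each rule produces at most one
  term that is not smaller than its left-hand side. By induction on this number it suffices to follow
  that leading term until either a left-hand side appears all of whose terms are smaller, or the word
  is standard. Leading terms obey the braid and interchange relations and the moves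
  \<open>s\<^sub>i u\<^sub>i\<^sub>+\<^sub>1 \<rightarrow> s\<^sub>i\<^sub>+\<^sub>1 u\<^sub>i\<close> and \<open>a\<^sub>i\<^sub>+\<^sub>1 s\<^sub>i \<rightarrow> a\<^sub>i s\<^sub>i\<^sub>+\<^sub>1\<close>.
  Modulo words that collapse, crossings and caps pass to the right of the cups \<open>I\<^sub>s\<close>,
  the cups are sorted among themselves, the caps are treated by the upside-down symmetry, and the
  remaining crossings are a word in the symmetric group, for which Matsumoto's theorem gives the
  chosen reduced expression or a factor \<open>s\<^sub>i s\<^sub>i\<close>.\<close>

section \<open>Dimension-free words and leading terms\<close>

text \<open>Neither count suffices alone: the cup-cap term of the twisting relation still has two
  letters, while straightening and looping remove no crossing. Hence a crossing weighs 2, a cup or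
  cap 1. Even this sum is constant under braiding, interchange and the \<open>e\<close>-terms of
  sliding, and the first two are reversible, so arbitrary sequences of steps need not end.
  Finiteness comes from inductively defined derivations that choose the steps. Only the words matter
  for the shape of the result. The coefficient of a leading term, be it a sign, a parameter or zero,
  is therefore forgotten in the geometric part and returns only in the soundness argument, which
  shows that every step is an equality of morphisms of the same type. Each geometric lemma thus
  becomes a dichotomy about a single word: it can be brought to a given shape, or a collapsing
  factor turns up on the way.\<close>

text \<open>The number of strands to the right of a letter is determined by the type of the diagram and is
  therefore dropped; positions are counted from \<open>0\<close>, unlike in \<open>s_fd\<close>, \<open>u_fd\<close> and \<open>a_fd\<close>.\<close>

type_synonym letter = "gen \<times> nat"

abbreviation S :: "nat \<Rightarrow> letter" where "S i \<equiv> (Cross, i)"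

text \<open>The rules that keep the number of letters and of crossings, with only the term of the right-hand
  side that has as many crossings as the left-hand side.\<close>

inductive lead :: "letter list \<Rightarrow> letter list \<Rightarrow> bool" where
  swap: "i + gdom g \<le> j \<Longrightarrow> lead [(g, i), (h, j)] [(h, j + gcod g - gdom g), (g, i)]"
| swap_back: "i + gcod g \<le> j \<Longrightarrow> lead [(h, j), (g, i)] [(g, i), (h, j + gdom g - gcod g)]"
| braid: "lead [S i, S (Suc i), S i] [S (Suc i), S i, S (Suc i)]"
| braid_back: "lead [S (Suc i), S i, S (Suc i)] [S i, S (Suc i), S i]"
| slide: "lead [S i, (Cup, Suc i)] [S (Suc i), (Cup, i)]"
| slide': "lead [(Cap, Suc i), S i] [(Cap, i), S (Suc i)]"

text \<open>Left-hand sides whose right-hand sides consist of smaller diagrams only.\<close>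

inductive collapses :: "letter list \<Rightarrow> bool" where
  untwist: "collapses [S i, (Cup, i)]"
| untwist': "collapses [(Cap, i), S i]"
| loop: "collapses [(Cap, i), (Cup, i)]"
| straighten: "collapses [(Cap, i), (Cup, Suc i)]"
| straighten': "collapses [(Cap, Suc i), (Cup, i)]"
| deloop: "collapses [(Cap, i), S (Suc i), (Cup, i)]"
| twist: "collapses [S i, S i]"
| pull: "collapses [S i, S (Suc i), (Cup, i)]"
| pull': "collapses [(Cap, i), S (Suc i), S i]"

text \<open>The rule \<open>collapse\<close> asks nothing about \<open>T\<close> or the rest of the
  word: there the induction on the weight takes over. So
  \<open>settles (\<lambda>_. False) w\<close> says that \<open>w\<close> certainly reaches a
  collapsing factor.\<close>

inductive settles :: "(letter list \<Rightarrow> bool) \<Rightarrow> letter list \<Rightarrow> bool" for T where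
  stop: "T w \<Longrightarrow> settles T w"
| step: "lead u v \<Longrightarrow> settles T (x @ v @ y) \<Longrightarrow> settles T (x @ u @ y)"
| collapse: "collapses u \<Longrightarrow> settles T (x @ u @ y)"

text \<open>A monadic bind inside a context: the derivation for the factor is replayed in the larger
  word and continued from its end, and a collapse of the factor is a collapse of the whole
  word.\<close>

lemma settles_ctx:
  assumes "settles T w" and "\<And>v. T v \<Longrightarrow> settles T' (x @ v @ y)"
  shows "settles T' (x @ w @ y)"
  using assms(1)
proof induction
  case (stop w)
  then show ?case using assms(2) by blast
next
  case (step u v x' y')
  then show ?case using settles.step[of u v T' "x @ x'" "y' @ y"] by simp
next
  case (collapse u x' y')
  then show ?case using settles.collapse[of u T' "x @ x'" "y' @ y"] by simp
qed

lemma settles_bind: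
  assumes "settles T w" and "\<And>v. T v \<Longrightarrow> settles T' v"
  shows "settles T' w"
  using settles_ctx[of T w T' "[]" "[]"] assms by simp

lemma settles_prepend:
  assumes "settles T w" and "\<And>v. T v \<Longrightarrow> settles T' (x @ v)"
  shows "settles T' (x @ w)"
  using settles_ctx[of T w T' x "[]"] assms by simp

lemma settles_append:
  assumes "settles T w" and "\<And>v. T v \<Longrightarrow> settles T' (v @ y)"
  shows "settles T' (w @ y)"
  using settles_ctx[of T w T' "[]" y] assms by simp

section \<open>Chains of leading terms without collapse\<close>

definition leads :: "letter list \<Rightarrow> letter list \<Rightarrow> bool" where
  "leads = (\<lambda>w v. \<exists>x y u u'. lead u u' \<and> w = x @ u @ y \<and> v = x @ u' @ y)\<^sup>*\<^sup>*"

lemma leads_refl [simp]: "leads w w"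
  by (simp add: leads_def)

lemma leads_trans [trans]: "leads u v \<Longrightarrow> leads v w \<Longrightarrow> leads u w"
  unfolding leads_def by (rule rtranclp_trans)

lemma lead_leads: "lead u v \<Longrightarrow> leads u v"
  unfolding leads_def by (rule r_into_rtranclp) (metis append_Nil append_Nil2)

lemma leads_settles: "leads u v \<Longrightarrow> settles T v \<Longrightarrow> settles T u"
  unfolding leads_def by (induction rule: converse_rtranclp_induct) (auto intro: settles.step)

lemma leads_stop: "leads w v \<Longrightarrow> T v \<Longrightarrow> settles T w"
  by (blast intro: leads_settles settles.stop)

lemma leads_ctx: "leads u v \<Longrightarrow> leads (x @ u @ y) (x @ v @ y)"
  unfolding leads_def
proof (induction rule: rtranclp_induct)
  case (step v w)
  then obtain x' y' u1 u2 where *: "lead u1 u2" "v = x' @ u1 @ y'" "w = x' @ u2 @ y'" by blast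
  show ?case
    by (rule rtranclp.rtrancl_into_rtrancl[OF step.IH], rule exI[of _ "x @ x'"],
        rule exI[of _ "y' @ y"], rule exI[of _ u1], rule exI[of _ u2]) (simp add: *)
qed simp

lemma leads_prepend: "leads u v \<Longrightarrow> leads (x @ u) (x @ v)"
  using leads_ctx[of u v x "[]"] by simp

lemma leads_append: "leads u v \<Longrightarrow> leads (u @ y) (v @ y)"
  using leads_ctx[of u v "[]" y] by simp

lemma leads_past:
  assumes "leads (a # u) (u' @ [a'])" and "leads (a' # v) (v' @ [a''])"
  shows "leads (a # u @ v) (u' @ v' @ [a''])"
  using leads_trans[OF leads_append[OF assms(1), of v]] leads_prepend[OF assms(2), of u'] by simp

text \<open>The crossings to the right of \<open>g\<close> move from its source to its target
  strands, so their positions change by the number of strands that \<open>g\<close> creates or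
  removes. The subtraction is exact because \<open>gdom g \<le> j\<close>.\<close>

lemma past_above:
  "\<forall>j\<in>set js. i + gdom g \<le> j \<Longrightarrow>
    leads ((g, i) # map S js) (map (\<lambda>j. S (j + gcod g - gdom g)) js @ [(g, i)])"
proof (induction js)
  case (Cons j js)
  then show ?case
    using leads_past[of "(g, i)" "[S j]" "[S (j + gcod g - gdom g)]" "(g, i)" "map S js"]
      lead_leads[OF lead.swap[of i g j Cross]] by simp
qed simp

lemma past_below:
  "\<forall>j\<in>set js. j + 2 \<le> i \<Longrightarrow> leads ((h, i) # map S js) (map S js @ [(h, i)])"
proof (induction js)
  case (Cons j js)
  then show ?case
    using leads_past[of "(h, i)" "[S j]" "[S j]" "(h, i)" "map S js"]
      lead_leads[OF lead.swap_back[of j Cross i h]] by simp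
qed simp

lemma past_far:
  assumes "(\<forall>j\<in>set js. i + 2 \<le> j)"
  shows "leads (S i # map S js) (map S js @ [S i])"
  using past_above[of js i Cross] assms by simp

section \<open>Crossings above cups\<close>

text \<open>This is a cup with left end at \<open>p\<close> whose right end has been carried across
  \<open>s\<close> strands to position \<open>p + s + 1\<close>; it is \<open>I_s\<close> with
  \<open>p\<close> counted from 0.\<close>

definition Iw :: "nat \<Rightarrow> nat \<Rightarrow> letter list" where
  "Iw p s = map S (rev [p + 1..<p + s + 1]) @ [(Cup, p)]"

lemma Iw_Suc: "Iw p (Suc s) = S (p + s + 1) # Iw p s"
  by (simp add: Iw_def)

lemma Iw_0: "Iw p 0 = [(Cup, p)]"
  by (simp add: Iw_def)

lemma Iw_split:
  assumes "i \<le> s"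
  shows "Iw p s = map S (rev [p + i + 1..<p + s + 1]) @ Iw p i"
proof -
  have "[p + 1..<p + s + 1] = [p + 1..<p + i + 1] @ [p + i + 1..<p + s + 1]"
    using upt_add_eq_append[of "p+1" "p+i+1" "s - i"] assms by simp
  then show ?thesis by (simp add: Iw_def)
qed

lemma map_shift_upt:
  assumes "d \<le> a"
  shows "map (\<lambda>j. S (j + c - d)) (rev [a..<b]) = map S (rev [a + c - d..<b + c - d])"
proof -
  have "map (\<lambda>j. j + c - d) [a..<b] = [a + c - d..<b + c - d]"
    by (rule nth_equalityI) (use assms in auto)
  then show ?thesis by (metis (no_types, lifting) map_map rev_map comp_apply map_cong)
qed

lemma past_Iw_above:
  assumes "i + gdom g \<le> p"
  shows "leads ((g, i) # Iw p s) (Iw (p + gcod g - gdom g) s @ [(g, i)])"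
proof -
  have eq: "map (\<lambda>j. S (j + gcod g - gdom g)) (rev [p + 1..<p + s + 1])
    = map S (rev [p + gcod g - gdom g + 1..<p + gcod g - gdom g + s + 1])"
  proof -
    have "p + 1 + gcod g - gdom g = p + gcod g - gdom g + 1"
      "p + s + 1 + gcod g - gdom g = p + gcod g - gdom g + s + 1" using assms by simp_all
    then show ?thesis
      using map_shift_upt[of "gdom g" "p + 1" "gcod g" "p + s + 1"] assms by (metis trans_le_add2 trans_le_add1 add_leE)
  qed
  have 1: "leads ((g, i) # map S (rev [p + 1..<p + s + 1]))
    (map S (rev [p + gcod g - gdom g + 1..<p + gcod g - gdom g + s + 1]) @ [(g, i)])"
    using past_above[of "rev [p + 1..<p + s + 1]" i g] assms unfolding eq by auto
  have 2: "leads ((g, i) # [(Cup, p)]) ([(Cup, p + gcod g - gdom g)] @ [(g, i)])"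
    using lead_leads[OF lead.swap[of i g p Cup]] assms by simp
  show ?thesis using leads_past[OF 1 2] by (simp add: Iw_def)
qed

lemma past_Iw_below:
  assumes "p + s + 2 \<le> i"
  shows "leads ((h, i) # Iw p s) (Iw p s @ [(h, i - 2)])"
proof -
  have 1: "leads ((h, i) # map S (rev [p + 1..<p + s + 1])) (map S (rev [p + 1..<p + s + 1]) @ [(h, i)])"
    by (rule past_below) (use assms in auto)
  have 2: "leads ((h, i) # [(Cup, p)]) ([(Cup, p)] @ [(h, i - 2)])"
    using lead_leads[OF lead.swap_back[of p Cup i h]] assms by simp
  show ?thesis using leads_past[OF 1 2] by (simp add: Iw_def)
qed

lemma settles_collapse_prefix: "collapses u \<Longrightarrow> settles T (u @ y)"
  using settles.collapse[of u T "[]" y] by simp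

lemma settles_collapse_suffix: "collapses u \<Longrightarrow> settles T (x @ u)"
  using settles.collapse[of u T x "[]"] by simp

text \<open>The crossing involves the strands \<open>i\<close> and \<open>i + 1\<close>, and the
  cases compare these with the two ends \<open>p\<close> and \<open>p + s + 1\<close> of the cup.
  Away from both ends the crossing passes, just outside an end it lengthens the cup by one, and at
  an end from inside it collapses. The possible values of \<open>p'\<close> are recorded for the
  exchange of two cups.\<close>

lemma cross_Iw:
  "settles (\<lambda>v. \<exists>p' s' is. v = Iw p' s' @ map S is \<and> (p' = p \<or> p' = i)) (S i # Iw p s)"
  (is "settles ?T _")
proof -
  consider "i + 2 \<le> p" | "i + 1 = p" | "i = p" "s = 0" | t where "i = p" "s = Suc t"
    | "p < i" "i < p + s" | "i = p + s" "s > 0" | "i = p + s + 1" | "p + s + 2 \<le> i"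
    by (metis (no_types, lifting) Suc_eq_plus1 add.right_neutral add_2_eq_Suc' gr0_implies_Suc
        linorder_neqE_nat not_less_eq_eq not_less_eq Suc_leI le_antisym gr0I)
  then show ?thesis
  proof cases
    case 1
    have "?T (Iw p s @ map S [i])" by blast
    moreover have "leads (S i # Iw p s) (Iw p s @ map S [i])"
      using past_Iw_above[of i Cross p s] 1 by simp
    ultimately show ?thesis by (rule leads_stop[rotated])
  next
    case 2
    have 1: "leads (S i # map S (rev [p + 1..<p + s + 1])) (map S (rev [p + 1..<p + s + 1]) @ [S i])"
      by (rule past_far) (use 2 in auto)
    have "leads (S i # Iw p s) (map S (rev [p + 1..<p + s + 1]) @ [S i, (Cup, p)])"
      using leads_append[OF 1, of "[(Cup, p)]"] by (simp add: Iw_def)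
    \<comment> \<open>Here \<open>p = i + 1\<close>: sliding moves the cup to \<open>i\<close>, and
      the new crossing \<open>S p\<close> is the lowest letter of the run that belongs to a cup at
      \<open>i\<close>.\<close>
    also have "leads \<dots> (map S (rev [p + 1..<p + s + 1]) @ [S p, (Cup, i)])"
      by (rule leads_prepend) (use lead_leads[OF lead.slide[of i]] 2 in simp)
    also have "map S (rev [p + 1..<p + s + 1]) @ [S p, (Cup, i)] = Iw i (Suc s)"
    proof -
      have "[i + 1..<i + Suc s + 1] = p # [p + 1..<p + s + 1]"
        using 2 by (subst upt_conv_Cons) (auto simp del: upt_Suc)
      then show ?thesis by (simp add: Iw_def del: upt_Suc)
    qed
    finally have *: "leads (S i # Iw p s) (Iw i (Suc s))" .
    have "?T (Iw i (Suc s))" by (rule exI[of _ i], rule exI[of _ "Suc s"], rule exI[of _ "[]"]) simp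
    then show ?thesis using * by (rule leads_stop[rotated])
  next
    case 3
    then show ?thesis using settles_collapse_prefix[OF collapses.untwist, of ?T i "[]"] by (simp add: Iw_0)
  next
    case 4
    have 1: "leads (S i # map S (rev [p + 2..<p + s + 1])) (map S (rev [p + 2..<p + s + 1]) @ [S i])"
      by (rule past_far) (use 4 in auto)
    have "Iw p s = map S (rev [p + 2..<p + s + 1]) @ [S (p + 1), (Cup, p)]"
      using Iw_split[of 1 s p] 4 by (simp add: Iw_def)
    then have "leads (S i # Iw p s) (map S (rev [p + 2..<p + s + 1]) @ [S p, S (Suc p), (Cup, p)])"
      using leads_append[OF 1, of "[S (p + 1), (Cup, p)]"] 4 by simp
    then show ?thesis by (rule leads_settles) (rule settles_collapse_suffix, rule collapses.pull)
  next
    case 5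
    \<comment> \<open>The run is cut so that its letters \<open>i + 1\<close> and \<open>i\<close>
      stand directly above \<open>Iw p t\<close>. Once \<open>S i\<close> has passed the higher
      letters, it forms a braid pattern with these two, and the last crossing of the result lies
      right of \<open>Iw p t\<close>.\<close>
    define t where "t = i - p - 1"
    have t: "i = p + t + 1" "t + 2 \<le> s" using 5 by (auto simp: t_def)
    let ?js = "rev [p + (t + 2) + 1..<p + s + 1]"
    have split: "Iw p s = map S ?js @ S (i + 1) # S i # Iw p t"
      using Iw_split[of "t + 2" s p] t by (simp add: Iw_Suc)
    have 1: "leads (S i # map S ?js) (map S ?js @ [S i])"
      by (rule past_far) (use t in auto)
    have 2: "leads (S (i + 1) # Iw p t) (Iw p t @ [S (i - 1)])"
      using past_Iw_below[of p t "i + 1"] t by simp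
    have "leads (S i # Iw p s) (map S ?js @ [S i, S (Suc i), S i] @ Iw p t)"
      using leads_append[OF 1, of "S (i + 1) # S i # Iw p t"] split by simp
    also have "leads \<dots> (map S ?js @ [S (Suc i), S i, S (Suc i)] @ Iw p t)"
      by (rule leads_ctx) (rule lead_leads[OF lead.braid])
    also have "leads \<dots> (map S ?js @ [S (Suc i), S i] @ Iw p t @ [S (i - 1)])"
      using leads_prepend[OF 2, of "map S ?js @ [S (Suc i), S i]"] by simp
    also have "\<dots> = Iw p s @ map S [i - 1]" using split by simp
    finally have *: "leads (S i # Iw p s) (Iw p s @ map S [i - 1])" .
    have "?T (Iw p s @ map S [i - 1])" by blast
    with * show ?thesis by (rule leads_stop)
  next
    case 6
    then obtain t where "s = Suc t" by (metis gr0_implies_Suc)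
    then show ?thesis using 6 settles_collapse_prefix[OF collapses.twist, of ?T i "Iw p t"] by (simp add: Iw_Suc)
  next
    case 7
    have "?T (Iw p (Suc s))" by (rule exI[of _ p], rule exI[of _ "Suc s"], rule exI[of _ "[]"]) simp
    then show ?thesis using 7 by (auto simp: Iw_Suc intro: settles.stop)
  next
    case 8
    have "?T (Iw p s @ map S [i - 2])" by blast
    moreover have "leads (S i # Iw p s) (Iw p s @ map S [i - 2])"
      using past_Iw_below[of p s i Cross] 8 by simp
    ultimately show ?thesis by (rule leads_stop[rotated])
  qed
qed

lemma crosses_Iw:
  "settles (\<lambda>v. \<exists>p' s' js. v = Iw p' s' @ map S js \<and> (p' = p \<or> p' \<in> set is)) (map S is @ Iw p s)"
proof (induction "is")
  case Nil
  have "Iw p s = Iw p s @ map S []" by simp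
  then show ?case by (auto intro!: settles.stop)
next
  case (Cons i "is")
  have "settles (\<lambda>v. \<exists>p' s' js. v = Iw p' s' @ map S js \<and> (p' = p \<or> p' \<in> set (i # is)))
    ([S i] @ map S is @ Iw p s)" (is "settles ?T _")
  proof (rule settles_prepend[OF Cons])
    fix v assume "\<exists>p' s' js. v = Iw p' s' @ map S js \<and> (p' = p \<or> p' \<in> set is)"
    then obtain q t js where v: "v = Iw q t @ map S js" "q = p \<or> q \<in> set is" by blast
    have "settles ?T ((S i # Iw q t) @ map S js)"
    proof (rule settles_append[OF cross_Iw])
      fix u assume "\<exists>p' s' is. u = Iw p' s' @ map S is \<and> (p' = q \<or> p' = i)"
      then obtain p' s' ks where "u = Iw p' s' @ map S ks" "p' = q \<or> p' = i" by blast
      then have "u @ map S js = Iw p' s' @ map S (ks @ js)" "p' = p \<or> p' \<in> set (i # is)"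
        using v(2) by auto
      then show "settles ?T (u @ map S js)" by (blast intro: settles.stop)
    qed
    then show "settles ?T ([S i] @ v)" using v by simp
  qed
  then show ?case by simp
qed

text \<open>Lifting the second cup over the first puts it at \<open>q + 2\<close>. It then meets
  only the run of the first cup, whose letters all exceed \<open>p\<close>, and a crossing can move
  the left end of a cup only to its own index. So the new upper cup starts strictly right of
  \<open>p\<close>; the crossings that come out below are absorbed by the cup left at
  \<open>p\<close>.\<close>

lemma Iw_swap:
  assumes "p \<le> q"
  shows "settles (\<lambda>v. \<exists>q' t' p' s' is. v = Iw q' t' @ Iw p' s' @ map S is \<and> p < q') (Iw p s @ Iw q t)"
  (is "settles ?T _")
proof -
  let ?is = "rev [p + 1..<p + s + 1]"
  have "leads (Iw p s @ Iw q t) (map S ?is @ Iw (q + 2) t @ [(Cup, p)])"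
    using leads_prepend[OF past_Iw_above[of p Cup q t], of "map S ?is"] assms by (simp add: Iw_def)
  moreover have "settles ?T ((map S ?is @ Iw (q + 2) t) @ [(Cup, p)])"
  proof (rule settles_append[OF crosses_Iw])
    fix v assume "\<exists>p' s' js. v = Iw p' s' @ map S js \<and> (p' = q + 2 \<or> p' \<in> set ?is)"
    then obtain q' t' js where v: "v = Iw q' t' @ map S js" "p < q'" using assms by auto
    have "settles ?T (Iw q' t' @ map S js @ Iw p 0)"
      by (rule settles_prepend[OF crosses_Iw]) (use v in \<open>blast intro: settles.stop\<close>)
    then show "settles ?T (v @ [(Cup, p)])" using v by (simp add: Iw_0)
  qed
  ultimately show ?thesis by (auto intro: leads_settles)
qed

section \<open>Products of cups, types of words, and sorting\<close>

definition Is :: "(nat \<times> nat) list \<Rightarrow> letter list" where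
  "Is ps = concat (map (\<lambda>(p, s). Iw p s) ps)"

lemma Is_simps [simp]: "Is [] = []" "Is ((p, s) # ps) = Iw p s @ Is ps"
  by (simp_all add: Is_def)

lemma Is_append: "Is (ps @ qs) = Is ps @ Is qs"
  by (simp add: Is_def)

text \<open>Positions and order of the cups may change, but their number is kept, which is what the
  induction in the sorting argument relies on.\<close>

lemma crosses_Is:
  "settles (\<lambda>v. \<exists>ps' js. v = Is ps' @ map S js \<and> length ps' = length ps) (map S is @ Is ps)"
proof (induction ps arbitrary: "is")
  case Nil
  have "map S is @ Is [] = Is [] @ map S is" by simp
  then show ?case by (blast intro: settles.stop)
next
  case (Cons a ps)
  obtain p s where a: "a = (p, s)" by force
  have "settles (\<lambda>v. \<exists>ps' js. v = Is ps' @ map S js \<and> length ps' = length (a # ps))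
    ((map S is @ Iw p s) @ Is ps)" (is "settles ?T _")
  proof (rule settles_append[OF crosses_Iw])
    fix v assume "\<exists>p' s' js. v = Iw p' s' @ map S js \<and> (p' = p \<or> p' \<in> set is)"
    then obtain p' s' js where v: "v = Iw p' s' @ map S js" by blast
    have "settles ?T (Iw p' s' @ map S js @ Is ps)"
    proof (rule settles_prepend[OF Cons.IH])
      fix u assume "\<exists>ps' js. u = Is ps' @ map S js \<and> length ps' = length ps"
      then obtain ps' js where "u = Is ps' @ map S js" "length ps' = length ps" by blast
      then have "Iw p' s' @ u = Is ((p', s') # ps') @ map S js"
        "length ((p', s') # ps') = length (a # ps)" by simp_all
      then show "settles ?T (Iw p' s' @ u)" by (blast intro: settles.stop)
    qed
    then show "settles ?T (v @ Is ps)" using v by simp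
  qed
  then show ?case using a by simp
qed

fun valid :: "nat \<Rightarrow> letter list \<Rightarrow> bool" where
  "valid n [] \<longleftrightarrow> True"
| "valid n ((g, l) # w) \<longleftrightarrow> l + gcod g \<le> n \<and> valid (n + gdom g - gcod g) w"

text \<open>A word is read from its target, so \<open>n\<close> counts the strands above the first
  letter and the result those below the last. On valid words the subtraction is exact.\<close>

fun bottom :: "nat \<Rightarrow> letter list \<Rightarrow> nat" where
  "bottom n [] = n"
| "bottom n ((g, l) # w) = bottom (n + gdom g - gcod g) w"

lemma bottom_append [simp]: "bottom n (x @ y) = bottom (bottom n x) y"
  by (induction n x rule: bottom.induct) auto

lemma valid_append [simp]: "valid n (x @ y) \<longleftrightarrow> valid n x \<and> valid (bottom n x) y"
  by (induction n x rule: bottom.induct) auto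

lemma lead_valid: "lead u v \<Longrightarrow> valid n u \<Longrightarrow> valid n v \<and> bottom n v = bottom n u"
  by (induction rule: lead.induct) auto

lemma settles_valid: "settles T w \<Longrightarrow> valid n w \<Longrightarrow> settles (\<lambda>v. T v \<and> valid n v \<and> bottom n v = bottom n w) w"
proof (induction rule: settles.induct)
  case (stop w)
  then show ?case by (simp add: settles.stop)
next
  case (step u v x y)
  then have "valid (bottom n x) v \<and> bottom (bottom n x) v = bottom (bottom n x) u" using lead_valid by simp
  then show ?case using step settles.step by simp
next
  case (collapse u x y)
  then show ?case by (simp add: settles.collapse)
qed

lemma valid_Iw: "valid n (Iw p s) \<Longrightarrow> p + s + 2 \<le> n"
  by (cases s) (auto simp: Iw_0 Iw_Suc)

abbreviation sortedI :: "(nat \<times> nat) list \<Rightarrow> bool" where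
  "sortedI ps \<equiv> sorted_wrt (\<lambda>a b. fst b < fst a) ps"

text \<open>Bubble sort: exchanging a cup with a cup further right increases the position at the head of the
  word, which is bounded by the number of strands.\<close>

lemma sort_Is:
  "valid n (Is ps @ map S is) \<Longrightarrow>
    settles (\<lambda>v. \<exists>ps' js. v = Is ps' @ map S js \<and> length ps' = length ps \<and> sortedI ps') (Is ps @ map S is)"
proof (induction "length ps" arbitrary: n ps "is")
  case 0
  have "Is ps @ map S is = Is [] @ map S is" using 0 by simp
  then show ?case using 0 by (intro settles.stop) auto
next
  case (Suc k)
  let ?T = "\<lambda>v. \<exists>ps' js. v = Is ps' @ map S js \<and> length ps' = Suc k \<and> sortedI ps'"
  \<comment> \<open>The tail has one cup less and is sorted by the outer hypothesis. An exchange at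
    the head spoils it again, because the crossings set free run through the remaining cups, but the
    tail keeps its length and the inner measure drops.\<close>
  have head: "settles ?T (Iw p s @ Is ps @ map S is)"
    if "length ps = k" "valid n (Iw p s @ Is ps @ map S is)" for p s ps "is"
    using that
  proof (induction "n - p" arbitrary: p s ps "is" rule: less_induct)
    case less
    have val: "valid (bottom n (Iw p s)) (Is ps @ map S is)" using less.prems by simp
    show ?case
    proof (rule settles_prepend[OF settles_valid[OF Suc.hyps(1)[OF less.prems(1)[symmetric] val] val]])
      fix v assume "(\<exists>ps' js. v = Is ps' @ map S js \<and> length ps' = length ps \<and> sortedI ps') \<and>
        valid (bottom n (Iw p s)) v \<and> bottom (bottom n (Iw p s)) v = bottom (bottom n (Iw p s)) (Is ps @ map S is)"
      then obtain ps' js where v: "v = Is ps' @ map S js" "length ps' = k" "sortedI ps'"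
        "valid (bottom n (Iw p s)) v" using less.prems(1) by auto
      show "settles ?T (Iw p s @ v)"
      proof (cases "ps' = [] \<or> fst (hd ps') < p")
        case True
        then have "sortedI ((p, s) # ps')" using v(3) by (cases ps') auto
        then have "?T (Iw p s @ v)"
          by (intro exI[of _ "(p, s) # ps'"] exI[of _ js]) (use v in simp)
        then show ?thesis by (rule settles.stop)
      next
        case False
        then obtain q t qs where ps': "ps' = (q, t) # qs" "p \<le> q" by (cases ps') auto
        have valv: "valid n (Iw p s @ Iw q t)" using less.prems v ps' by simp
        have valv': "valid n ((Iw p s @ Iw q t) @ Is qs @ map S js)" using less.prems v ps' by simp
        have "settles ?T ((Iw p s @ Iw q t) @ Is qs @ map S js)"
        proof (rule settles_append[OF settles_valid[OF Iw_swap[OF ps'(2)] valv]])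
          fix u assume "(\<exists>q' t' p' s' is. u = Iw q' t' @ Iw p' s' @ map S is \<and> p < q') \<and>
            valid n u \<and> bottom n u = bottom n (Iw p s @ Iw q t)"
          then obtain q' t' p' s' ks where u: "u = Iw q' t' @ Iw p' s' @ map S ks" "p < q'"
            "valid n u" "bottom n u = bottom n (Iw p s @ Iw q t)" by blast
          have valu: "valid n (u @ Is qs @ map S js)" using u valv' by simp
          have valm: "valid (bottom n (Iw q' t' @ Iw p' s')) (map S ks @ Is qs)"
            using valu u by simp
          have "settles ?T ((Iw q' t' @ Iw p' s') @ (map S ks @ Is qs) @ map S js)"
          proof (rule settles_ctx[OF settles_valid[OF crosses_Is valm]])
            fix z assume "(\<exists>ps' js. z = Is ps' @ map S js \<and> length ps' = length qs) \<and>
              valid (bottom n (Iw q' t' @ Iw p' s')) z \<and>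
              bottom (bottom n (Iw q' t' @ Iw p' s')) z = bottom (bottom n (Iw q' t' @ Iw p' s')) (map S ks @ Is qs)"
            then obtain rs ls where z: "z = Is rs @ map S ls" "length rs = length qs"
              "valid (bottom n (Iw q' t' @ Iw p' s')) z"
              "bottom (bottom n (Iw q' t' @ Iw p' s')) z = bottom (bottom n (Iw q' t' @ Iw p' s')) (map S ks @ Is qs)"
              by blast
            have eq: "(Iw q' t' @ Iw p' s') @ z @ map S js
              = Iw q' t' @ Is ((p', s') # rs) @ map S (ls @ js)" using z by simp
            have "valid n ((Iw q' t' @ Iw p' s') @ z @ map S js)"
              using z(3,4) valu u(1) by simp
            then have val2: "valid n (Iw q' t' @ Is ((p', s') # rs) @ map S (ls @ js))"
              unfolding eq .
            \<comment> \<open>Validity keeps the new head inside the \<open>n\<close> strands, so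
              that the truncated difference \<open>n - q'\<close> really is smaller than
              \<open>n - p\<close>.\<close>
            then have "q' + t' + 2 \<le> n" using valid_Iw by simp
            then have "n - q' < n - p" using u(2) by linarith
            moreover have "length ((p', s') # rs) = k" using v(2) ps'(1) z(2) by simp
            ultimately have "settles ?T (Iw q' t' @ Is ((p', s') # rs) @ map S (ls @ js))"
              using less.hyps val2 by blast
            then show "settles ?T ((Iw q' t' @ Iw p' s') @ z @ map S js)" unfolding eq .
          qed
          then show "settles ?T (u @ Is qs @ map S js)" using u by simp
        qed
        then show ?thesis using v ps' by simp
      qed
    qed
  qed
  obtain p s qs where ps: "ps = (p, s) # qs" "length qs = k"
    using Suc.hyps(2) by (cases ps) auto
  then show ?case using head[of qs p s "is"] Suc.prems by simp
qed

section \<open>Caps above cups\<close>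

text \<open>The left foot of the cap stands on the right end of the cup. Upside-down sliding lets
  the cap follow that end inwards, one letter of the run at a time, until it stands next to the bare
  cup and straightening applies.\<close>

lemma cap_next_Iw: "settles T ((Cap, p + s + 1) # Iw p s)"
proof (induction s arbitrary: T)
  case 0
  show ?case using settles_collapse_prefix[OF collapses.straighten', of T p "[]"] by (simp add: Iw_0)
next
  case (Suc s)
  have "leads ((Cap, p + Suc s + 1) # Iw p (Suc s)) ((Cap, p + s + 1) # S (p + s + 2) # Iw p s)"
    using leads_append[OF lead_leads[OF lead.slide'[of "p + s + 1"]], of "Iw p s"] by (simp add: Iw_Suc)
  also have "leads \<dots> (((Cap, p + s + 1) # Iw p s) @ [S (p + s)])"
    using leads_prepend[OF past_Iw_below[of p s "p + s + 2" Cross], of "[(Cap, p + s + 1)]"] by simp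
  \<comment> \<open>With the unsatisfiable target \<open>\<lambda>_. False\<close> the prefix is
    known to collapse, so there is no continuation to supply for the crossing behind it.\<close>
  finally show ?case
    by (rule leads_settles) (rule settles_append[OF Suc.IH[of "\<lambda>_. False"]], simp)
qed

text \<open>A cap meeting one of the two ends of the cup collapses, and so does one between them; all other
  caps pass.\<close>

lemma cap_Iw: "settles (\<lambda>v. \<exists>p' s' i'. v = Iw p' s' @ [(Cap, i')]) ((Cap, i) # Iw p s)"
  (is "settles ?T _")
proof -
  \<comment> \<open>The cap passes all run letters that lie entirely to its right; each loses two
    strands on its left, whence \<open>j + 0 - 2\<close>. In the collapsing cases \<open>t\<close>
    is chosen so that the cap and the first letters of \<open>Iw p t\<close> form a left-hand
    side.\<close>
  have into: "leads ((Cap, i) # Iw p s) (map (\<lambda>j. S (j + 0 - 2)) (rev [p + t + 1..<p + s + 1]) @ (Cap, i) # Iw p t)"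
    if "t \<le> s" "i + 2 \<le> p + t + 1" for t
  proof -
    have "leads ((Cap, i) # map S (rev [p + t + 1..<p + s + 1]))
      (map (\<lambda>j. S (j + 0 - 2)) (rev [p + t + 1..<p + s + 1]) @ [(Cap, i)])"
      using past_above[of "rev [p + t + 1..<p + s + 1]" i Cap] that by auto
    then show ?thesis using leads_append[of _ _ "Iw p t"] Iw_split[OF that(1), of p] by fastforce
  qed
  consider "i + 2 \<le> p" | "i + 1 = p" | "i = p" "s = 0" | "i = p" "s > 0"
    | "p < i" "i < p + s" | "i = p + s" "s > 0" | "i = p + s + 1" | "p + s + 2 \<le> i"
    by linarith
  then show ?thesis
  proof cases
    case 1
    then show ?thesis using past_Iw_above[of i Cap p s]
      by (intro leads_settles[OF past_Iw_above] settles.stop) auto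
  next
    case 2
    have "settles ?T (x @ [(Cap, i), (Cup, Suc i)])" for x
      by (rule settles_collapse_suffix[OF collapses.straighten])
    then show ?thesis using leads_settles[OF into[of 0]] 2 by (auto simp: Iw_0)
  next
    case 3
    then show ?thesis using settles_collapse_prefix[OF collapses.loop, of ?T i "[]"] by (simp add: Iw_0)
  next
    case 4
    have "settles ?T (x @ [(Cap, p), S (Suc p), (Cup, p)])" for x
      by (rule settles_collapse_suffix[OF collapses.deloop])
    moreover have "Iw p 1 = [S (Suc p), (Cup, p)]" by (simp add: Iw_def)
    ultimately show ?thesis using leads_settles[OF into[of 1]] 4 by simp
  next
    case 5
    define t where "t = i - p - 1"
    have t: "i = p + t + 1" "t + 2 \<le> s" using 5 by (auto simp: t_def)
    have "settles ?T ([(Cap, i), S (Suc i), S i] @ Iw p t)"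
      by (rule settles_collapse_prefix[OF collapses.pull'])
    then have "settles ?T ((Cap, i) # Iw p (t + 2))" using t by (simp add: Iw_Suc)
    then have "settles ?T (map (\<lambda>j. S (j + 0 - 2)) (rev [p + (t + 2) + 1..<p + s + 1]) @ (Cap, i) # Iw p (t + 2))"
      using settles.collapse[OF collapses.pull'[of i], of ?T _ "Iw p t"] t by (simp add: Iw_Suc)
    then show ?thesis using leads_settles[OF into[of "t + 2"]] t by simp
  next
    case 6
    then obtain t where "s = Suc t" by (metis gr0_implies_Suc)
    then show ?thesis using 6 settles_collapse_prefix[OF collapses.untwist', of ?T i "Iw p t"]
      by (simp add: Iw_Suc)
  next
    case 7
    then show ?thesis using cap_next_Iw by simp
  next
    case 8
    then show ?thesis by (intro leads_settles[OF past_Iw_below] settles.stop) auto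
  qed
qed

lemma cap_Is: "settles (\<lambda>v. \<exists>ps' i'. v = Is ps' @ [(Cap, i')]) ((Cap, i) # Is ps)"
proof (induction ps arbitrary: i)
  case Nil
  have "[(Cap, i)] = Is [] @ [(Cap, i)]" by simp
  then show ?case by (metis (mono_tags, lifting) Is_simps(1) settles.stop)
next
  case (Cons a ps)
  obtain p s where a: "a = (p, s)" by force
  have "settles (\<lambda>v. \<exists>ps' i'. v = Is ps' @ [(Cap, i')]) (((Cap, i) # Iw p s) @ Is ps)" (is "settles ?T _")
  proof (rule settles_append[OF cap_Iw])
    fix v assume "\<exists>p' s' i'. v = Iw p' s' @ [(Cap, i')]"
    then obtain p' s' j where v: "v = Iw p' s' @ [(Cap, j)]" by blast
    have "settles ?T (Iw p' s' @ (Cap, j) # Is ps)"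
    proof (rule settles_prepend[OF Cons.IH])
      fix u assume "\<exists>ps' i'. u = Is ps' @ [(Cap, i')]"
      then obtain ps' i' where "u = Is ps' @ [(Cap, i')]" by blast
      then have "Iw p' s' @ u = Is ((p', s') # ps') @ [(Cap, i')]" by simp
      then show "settles ?T (Iw p' s' @ u)" by (blast intro: settles.stop)
    qed
    then show "settles ?T (v @ Is ps)" using v by simp
  qed
  then show ?case using a by simp
qed

section \<open>Turning diagrams upside down\<close>

fun flip_gen :: "gen \<Rightarrow> gen" where
  "flip_gen Cross = Cross" | "flip_gen Cap = Cup" | "flip_gen Cup = Cap"

definition flip :: "letter list \<Rightarrow> letter list" where
  "flip w = rev (map (\<lambda>(g, i). (flip_gen g, i)) w)"

lemma flip_simps [simp]:
  "flip [] = []" "flip ((g, i) # w) = flip w @ [(flip_gen g, i)]" "flip (x @ y) = flip y @ flip x"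
  by (simp_all add: flip_def)

lemma flip_gen_simps [simp]:
  "flip_gen (flip_gen g) = g" "gdom (flip_gen g) = gcod g" "gcod (flip_gen g) = gdom g"
  by (cases g; simp)+

lemma flip_flip [simp]: "flip (flip w) = w"
  by (induction w) auto

lemma flip_cross [simp]: "flip (map S is) = map S (rev is)"
  by (induction "is") auto

lemma lead_flip: "lead u v \<Longrightarrow> lead (flip u) (flip v)"
proof (induction rule: lead.induct)
  case (swap i g j h)
  then show ?case using lead.swap_back[of i "flip_gen g" j "flip_gen h"] by simp
next
  case (swap_back i g j h)
  then show ?case using lead.swap[of i "flip_gen g" j "flip_gen h"] by simp
qed (auto intro: lead.intros)

lemma collapses_flip: "collapses u \<Longrightarrow> collapses (flip u)"
  by (induction rule: collapses.induct) (auto intro: collapses.intros)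

lemma settles_flip: "settles T w \<Longrightarrow> settles (\<lambda>v. T (flip v)) (flip w)"
proof (induction rule: settles.induct)
  case (step u v x y)
  then show ?case using settles.step[OF lead_flip[OF step(1)], of _ "flip y" "flip x"] by simp
next
  case (collapse u x y)
  then show ?case using settles.collapse[OF collapses_flip[OF collapse(1)], of _ "flip y" "flip x"] by simp
qed (simp add: settles.stop)

lemma valid_flip: "valid n w \<Longrightarrow> valid (bottom n w) (flip w) \<and> bottom (bottom n w) (flip w) = n"
  by (induction n w rule: bottom.induct) auto

section \<open>Caps as mirror images of cups\<close>

definition Jw :: "nat \<Rightarrow> nat \<Rightarrow> letter list" where
  "Jw p s = (Cap, p) # map S [p + 1..<p + s + 1]"

definition Js :: "(nat \<times> nat) list \<Rightarrow> letter list" where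
  "Js ps = concat (map (\<lambda>(p, s). Jw p s) ps)"

abbreviation sortedJ :: "(nat \<times> nat) list \<Rightarrow> bool" where
  "sortedJ ps \<equiv> sorted_wrt (\<lambda>a b. fst a < fst b) ps"

lemma flip_Js: "flip (Js ps) = Is (rev ps)"
  by (induction ps) (auto simp: Js_def Jw_def Is_append Iw_def)

lemma flip_Is: "flip (Is ps) = Js (rev ps)"
  by (metis flip_Js flip_flip rev_rev_ident)

text \<open>This is the mirror image of a cap arriving above crossings and caps. A bare cup is
  \<open>Iw i 0\<close>, so it rises through the crossings and becomes the last factor of the
  product of cups before that is sorted.\<close>

lemma sort_Is_cup:
  assumes "valid n (Is ps @ map S is @ [(Cup, i)])"
  shows "settles (\<lambda>v. \<exists>ps' js. v = Is ps' @ map S js \<and> sortedI ps') (Is ps @ map S is @ [(Cup, i)])"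
    (is "settles ?T _")
proof (rule settles_bind)
  have "settles (\<lambda>v. \<exists>qs js. v = Is qs @ map S js) (Is ps @ map S is @ Iw i 0)" (is "settles ?Q _")
  proof (rule settles_prepend[OF crosses_Iw])
    fix v assume "\<exists>p' s' js. v = Iw p' s' @ map S js \<and> (p' = i \<or> p' \<in> set is)"
    then obtain p' s' js where "v = Iw p' s' @ map S js" by blast
    then have "Is ps @ v = Is (ps @ [(p', s')]) @ map S js" by (simp add: Is_append)
    then show "settles ?Q (Is ps @ v)" by (blast intro: settles.stop)
  qed
  then show "settles (\<lambda>v. ?Q v \<and> valid n v \<and> bottom n v = bottom n (Is ps @ map S is @ [(Cup, i)]))
      (Is ps @ map S is @ [(Cup, i)])"
    by (intro settles_valid assms) (simp add: Iw_0)
next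
  fix v assume "(\<exists>qs js. v = Is qs @ map S js) \<and> valid n v \<and> bottom n v = bottom n (Is ps @ map S is @ [(Cup, i)])"
  then obtain qs js where v: "v = Is qs @ map S js" "valid n v" by blast
  show "settles ?T v"
    by (rule settles_bind[OF sort_Is[of n qs js, folded v(1), OF v(2)]]) (blast intro: settles.stop)
qed

lemma sort_Js_cap:
  assumes "valid n ((Cap, i) # map S is @ Js qs)"
  shows "settles (\<lambda>v. \<exists>js qs'. v = map S js @ Js qs' \<and> sortedJ qs') ((Cap, i) # map S is @ Js qs)"
    (is "settles ?T ?w")
proof -
  have eq: "flip ?w = Is (rev qs) @ map S (rev is) @ [(Cup, i)]" by (simp add: flip_Js)
  have "valid (bottom n ?w) (flip ?w)" using valid_flip assms by blast
  then have "settles (\<lambda>v. \<exists>ps' js. v = Is ps' @ map S js \<and> sortedI ps') (flip ?w)"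
    unfolding eq by (rule sort_Is_cup)
  from settles_flip[OF this] have 1: "settles (\<lambda>v. \<exists>ps' js. flip v = Is ps' @ map S js \<and> sortedI ps') ?w"
    unfolding flip_flip .
  show ?thesis
  proof (rule settles_bind[OF 1])
    fix v assume "\<exists>ps' js. flip v = Is ps' @ map S js \<and> sortedI ps'"
    then obtain ps js where *: "flip v = Is ps @ map S js" "sortedI ps" by blast
    then have "v = flip (Is ps @ map S js)" by (metis flip_flip)
    then have "v = map S (rev js) @ Js (rev ps)" by (simp add: flip_Is)
    moreover have "sortedJ (rev ps)" using *(2) by (simp add: sorted_wrt_rev)
    ultimately show "settles ?T v" by (blast intro: settles.stop)
  qed
qed

text \<open>Letters are put one at a time on top of a word already in shape. A cup joins the cups, a
  crossing is pushed through them into the middle, and a cap that survives the cups is absorbed by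
  the crossings and caps below.\<close>

lemma settles_IXJ:
  "valid n w \<Longrightarrow>
    settles (\<lambda>v. \<exists>ps is qs. v = Is ps @ map S is @ Js qs \<and> sortedI ps \<and> sortedJ qs) w"
proof (induction w arbitrary: n)
  case Nil
  have "[] = Is [] @ map S [] @ Js []" by (simp add: Js_def)
  then show ?case by (intro settles.stop) fastforce
next
  case (Cons x w)
  let ?T = "\<lambda>v. \<exists>ps is qs. v = Is ps @ map S is @ Js qs \<and> sortedI ps \<and> sortedJ qs"
  obtain g i where x: "x = (g, i)" by force
  have val: "valid (bottom n [x]) w" using Cons.prems x by simp
  \<comment> \<open>Any kind of new letter can disturb the order of the cups, so sorting them is the
    last step in all three cases. It may add crossings to the middle but does not touch
    \<open>Js qs\<close>.\<close>
  have sorted: "settles ?T (Is ps @ map S is @ Js qs)"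
    if "valid n (Is ps @ map S is)" "sortedJ qs" for ps "is" qs
  proof -
    have "settles ?T ((Is ps @ map S is) @ Js qs)"
    proof (rule settles_append[OF sort_Is[OF that(1)]])
      fix v assume "\<exists>ps' js. v = Is ps' @ map S js \<and> length ps' = length ps \<and> sortedI ps'"
      then have "?T (v @ Js qs)" using that(2) by fastforce
      then show "settles ?T (v @ Js qs)" by (rule settles.stop)
    qed
    then show ?thesis by simp
  qed
  have "settles ?T ([x] @ w)"
  proof (rule settles_prepend[OF settles_valid[OF Cons.IH[OF val] val]])
    fix v assume "?T v \<and> valid (bottom n [x]) v \<and> bottom (bottom n [x]) v = bottom (bottom n [x]) w"
    then obtain ps "is" qs where v: "v = Is ps @ map S is @ Js qs" "sortedI ps" "sortedJ qs"
      "valid (bottom n [x]) v" by blast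
    then have valx: "valid n (x # Is ps @ map S is @ Js qs)" using Cons.prems x by simp
    show "settles ?T ([x] @ v)"
    proof (cases g)
      case Cup
      have "settles ?T (Is ((i, 0) # ps) @ map S is @ Js qs)"
        by (rule sorted) (use valx v x Cup in \<open>simp_all add: Iw_0\<close>)
      then show ?thesis using v x Cup by (simp add: Iw_0)
    next
      case Cross
      have val1: "valid n (map S [i] @ Is ps)" using valx x Cross by simp
      have "settles ?T ((map S [i] @ Is ps) @ map S is @ Js qs)"
      proof (rule settles_append[OF settles_valid[OF crosses_Is val1]])
        fix u assume "(\<exists>ps' js. u = Is ps' @ map S js \<and> length ps' = length ps) \<and> valid n u \<and> bottom n u = bottom n (map S [i] @ Is ps)"
        then obtain ps' js where u: "u = Is ps' @ map S js" "valid n u" "bottom n u = bottom n (map S [i] @ Is ps)" by blast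
        have "valid n (u @ map S is)" using valx x Cross u(2,3) by simp
        then have "valid n (Is ps' @ map S (js @ is))" using u(1) by simp
        then have "settles ?T (Is ps' @ map S (js @ is) @ Js qs)" using sorted v(3) by blast
        then show "settles ?T (u @ map S is @ Js qs)" using u(1) by simp
      qed
      then show ?thesis using v x Cross by simp
    next
      case Cap
      have val1: "valid n ((Cap, i) # Is ps)" using valx x Cap by simp
      have "settles ?T (((Cap, i) # Is ps) @ map S is @ Js qs)"
      proof (rule settles_append[OF settles_valid[OF cap_Is val1]])
        fix u assume "(\<exists>ps' i'. u = Is ps' @ [(Cap, i')]) \<and> valid n u \<and> bottom n u = bottom n ((Cap, i) # Is ps)"
        then obtain ps' j where u: "u = Is ps' @ [(Cap, j)]" "valid n u" "bottom n u = bottom n ((Cap, i) # Is ps)" by blast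
        have "valid n (u @ map S is @ Js qs)" using valx x Cap u(2,3) by simp
        then have valj: "valid n (Is ps')" "valid (bottom n (Is ps')) ((Cap, j) # map S is @ Js qs)"
          using u(1) by simp_all
        have "settles ?T (Is ps' @ (Cap, j) # map S is @ Js qs)"
        proof (rule settles_prepend[OF settles_valid[OF sort_Js_cap[OF valj(2)] valj(2)]])
          fix z assume "(\<exists>js qs'. z = map S js @ Js qs' \<and> sortedJ qs') \<and> valid (bottom n (Is ps')) z \<and>
            bottom (bottom n (Is ps')) z = bottom (bottom n (Is ps')) ((Cap, j) # map S is @ Js qs)"
          then obtain js qs' where "z = map S js @ Js qs'" "sortedJ qs'" "valid (bottom n (Is ps')) z" by blast
          then show "settles ?T (Is ps' @ z)" using sorted[of ps' js qs'] valj(1) by simp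
        qed
        then show "settles ?T (u @ map S is @ Js qs)" using u(1) by simp
      qed
      then show ?thesis using v x Cap by simp
    qed
  qed
  then show ?case by simp
qed

section \<open>The word problem of the symmetric group\<close>

inductive braid_move :: "nat list \<Rightarrow> nat list \<Rightarrow> bool" where
  commute: "i + 2 \<le> j \<Longrightarrow> braid_move [i, j] [j, i]"
| commute_back: "i + 2 \<le> j \<Longrightarrow> braid_move [j, i] [i, j]"
| braid: "braid_move [i, Suc i, i] [Suc i, i, Suc i]"
| braid_back: "braid_move [Suc i, i, Suc i] [i, Suc i, i]"

text \<open>Cancelling \<open>[j, j]\<close> is deliberately excluded: a squared crossing is not an
  identity in the supercategory but a collapse, so it must surface as an explicit factor. Indices
  are counted from 1, as in \<open>HH r\<close>.\<close>

inductive braid_eq :: "nat list \<Rightarrow> nat list \<Rightarrow> bool" where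
  refl: "braid_eq w w"
| step: "braid_move u v \<Longrightarrow> braid_eq (x @ v @ y) w \<Longrightarrow> braid_eq (x @ u @ y) w"

declare braid_eq.refl [simp, intro]

lemma braid_eq_trans [trans]: "braid_eq u v \<Longrightarrow> braid_eq v w \<Longrightarrow> braid_eq u w"
  by (induction rule: braid_eq.induct) (auto intro: braid_eq.step)

lemma braid_move_eq: "braid_move u v \<Longrightarrow> braid_eq (x @ u @ y) (x @ v @ y)"
  by (rule braid_eq.step) auto

lemma braid_move_sym: "braid_move u v \<Longrightarrow> braid_move v u"
  by (induction rule: braid_move.induct) (auto intro: braid_move.intros)

lemma braid_eq_sym: "braid_eq u v \<Longrightarrow> braid_eq v u"
  by (induction rule: braid_eq.induct) (auto intro: braid_eq_trans braid_move_eq braid_move_sym)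

lemma braid_eq_ctx: "braid_eq u v \<Longrightarrow> braid_eq (x @ u @ y) (x @ v @ y)"
proof (induction rule: braid_eq.induct)
  case (step u v x' y' w)
  then show ?case using braid_eq.step[of u v "x @ x'" "y' @ y"] by simp
qed simp

lemma braid_eq_append: "braid_eq u v \<Longrightarrow> braid_eq (u @ y) (v @ y)"
  using braid_eq_ctx[of u v "[]" y] by simp

lemma braid_eq_prepend: "braid_eq u v \<Longrightarrow> braid_eq (x @ u) (x @ v)"
  using braid_eq_ctx[of u v x "[]"] by simp

lemma word_perm_append: "word_perm (u @ v) = word_perm u \<circ> word_perm v"
  by (induction u) auto

lemma braid_move_perm: "braid_move u v \<Longrightarrow> word_perm u = word_perm v"
  by (induction rule: braid_move.induct) (auto simp: fun_eq_iff transpose_def)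

lemma braid_eq_perm: "braid_eq u v \<Longrightarrow> word_perm u = word_perm v"
  by (induction rule: braid_eq.induct) (auto simp: word_perm_append dest: braid_move_perm)

lemma braid_eq_length: "braid_eq u v \<Longrightarrow> length u = length v"
  by (induction rule: braid_eq.induct) (auto elim: braid_move.cases)

lemma braid_eq_is_word: "braid_eq u v \<Longrightarrow> is_word r u \<longleftrightarrow> is_word r v"
  by (induction rule: braid_eq.induct) (auto simp: is_word_def elim!: braid_move.cases)

lemma commute_right: "\<forall>j\<in>set w. i + 2 \<le> j \<or> j + 2 \<le> i \<Longrightarrow> braid_eq (i # w) (w @ [i])"
proof (induction w)
  case (Cons j w)
  then have "braid_move [i, j] [j, i]" by (auto intro: braid_move.intros)
  then have "braid_eq (i # j # w) (j # i # w)" using braid_move_eq[of _ _ "[]" w] by fastforce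
  also have "braid_eq \<dots> (j # w @ [i])" using Cons braid_eq_prepend[of _ _ "[j]"] by simp
  finally show ?case by simp
qed simp

text \<open>Normal forms of \<open>S\<^sub>r\<close>: products of descending runs \<open>s\<^sub>q \<dots> s\<^sub>t\<close> with \<open>q = 1, \<dots>, r - 1\<close>.\<close>

fun run_word :: "nat \<Rightarrow> nat list \<Rightarrow> bool" where
  "run_word 0 w \<longleftrightarrow> w = []"
| "run_word (Suc 0) w \<longleftrightarrow> w = []"
| "run_word (Suc (Suc q)) w \<longleftrightarrow>
     (\<exists>u t. run_word (Suc q) u \<and> 1 \<le> t \<and> t \<le> q + 2 \<and> w = u @ rev [t..<q + 2])"

lemma run_word_is_word: "run_word r w \<Longrightarrow> is_word r w"
  by (induction r w rule: run_word.induct) (fastforce simp: is_word_def)+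

lemma run_word_Nil: "run_word r []"
proof (induction r "[] :: nat list" rule: run_word.induct)
  case (3 q)
  then show ?case by (auto intro!: exI[of _ "[]"] exI[of _ "q + 2"])
qed auto

text \<open>The new letter meets the last run \<open>s_(q+1) ... s_t\<close>. It prolongs the run if
  \<open>i + 1 = t\<close>, makes a square if \<open>i = t\<close>, and otherwise passes to the left
  of the run, unchanged if \<open>i + 1 < t\<close> and as \<open>i - 1\<close> by a braid move if
  \<open>t < i\<close>. After passing it has index at most \<open>q\<close>, where the induction
  hypothesis for the shorter normal form applies.\<close>

lemma run_word_snoc:
  "run_word r w \<Longrightarrow> 1 \<le> i \<Longrightarrow> i < r \<Longrightarrow>
    \<exists>v. braid_eq (w @ [i]) v \<and> (run_word r v \<or> (\<exists>x j y. v = x @ [j, j] @ y))"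
proof (induction r w arbitrary: i rule: run_word.induct)
  case (3 q w)
  let ?C = "\<lambda>z. \<exists>v. braid_eq z v \<and> (run_word (Suc (Suc q)) v \<or> (\<exists>x j y. v = x @ [j, j] @ y))"
  obtain u t where u: "run_word (Suc q) u" "1 \<le> t" "t \<le> q + 2" "w = u @ rev [t..<q + 2]"
    using 3 by auto
  have trans: "?C z" if "braid_eq z z'" "?C z'" for z z'
    using that braid_eq_trans by blast
  have inner: "?C (u @ [k] @ rev [t..<q + 2])" if "1 \<le> k" "k \<le> q" for k
  proof -
    obtain v where v: "braid_eq (u @ [k]) v" "run_word (Suc q) v \<or> (\<exists>x j y. v = x @ [j, j] @ y)"
      using "3.IH"[OF u(1), of k] \<open>1 \<le> k\<close> \<open>k \<le> q\<close> by auto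
    have "braid_eq (u @ [k] @ rev [t..<q + 2]) (v @ rev [t..<q + 2])"
      using braid_eq_append[OF v(1)] by simp
    moreover from v(2) have "run_word (Suc (Suc q)) (v @ rev [t..<q + 2]) \<or>
      (\<exists>x j y. v @ rev [t..<q + 2] = x @ [j, j] @ y)"
    proof
      assume "run_word (Suc q) v" then show ?thesis using u by auto
    next
      assume "\<exists>x j y. v = x @ [j, j] @ y"
      then obtain x j y where "v @ rev [t..<q + 2] = x @ [j, j] @ (y @ rev [t..<q + 2])" by auto
      then show ?thesis by blast
    qed
    ultimately show ?thesis by blast
  qed
  consider "i + 1 = t" | "i + 1 < t" | "i = t" | "t < i" by linarith
  then show ?case
  proof cases
    case 1
    then have "w @ [i] = u @ rev [i..<q + 2]"
      using u(4) upt_conv_Cons[of i "q + 2"] "3.prems" by simp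
    then have "run_word (Suc (Suc q)) (w @ [i])"
      unfolding run_word.simps using u(1) "3.prems"(2,3)
      by (intro exI[of _ u] exI[of _ i]) auto
    then show ?thesis by blast
  next
    case 2
    have "braid_eq (i # rev [t..<q + 2]) (rev [t..<q + 2] @ [i])"
      by (rule commute_right) (use 2 in auto)
    from braid_eq_prepend[OF braid_eq_sym[OF this], of u]
    have "braid_eq (w @ [i]) (u @ [i] @ rev [t..<q + 2])" using u(4) by (simp del: upt_Suc)
    moreover have "i \<le> q" using 2 u by simp
    ultimately show ?thesis using trans inner "3.prems" by blast
  next
    case 3
    then have "w @ [i] = (u @ rev [t + 1..<q + 2]) @ [i, i] @ []"
      using u upt_conv_Cons[of t "q + 2"] \<open>i < Suc (Suc q)\<close> by (simp del: upt_Suc)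
    then show ?thesis by blast
  next
    case 4
    define a where "a = rev [i + 1..<q + 2]"
    define b where "b = rev [t..<i - 1]"
    have "[t..<q + 2] = [t..<i - 1] @ [i - 1..<q + 2]"
      using upt_add_eq_append[of t "i - 1" "q + 2 - (i - 1)"] 4 \<open>i < Suc (Suc q)\<close> by simp
    moreover have "[i - 1..<q + 2] = (i - 1) # i # [i + 1..<q + 2]"
      using 4 \<open>i < Suc (Suc q)\<close> upt_conv_Cons[of "i - 1" "q + 2"] upt_conv_Cons[of i "q + 2"] by simp
    ultimately have run: "rev [t..<q + 2] = a @ [i, i - 1] @ b"
      by (simp add: a_def b_def)
    have i: "Suc (i - 1) = i" using 4 by simp
    have "braid_eq (b @ [i]) (i # b)"
      by (rule braid_eq_sym, rule commute_right) (auto simp: b_def)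
    from braid_eq_prepend[OF this, of "u @ a @ [i, i - 1]"]
    have "braid_eq (w @ [i]) ((u @ a) @ [i, i - 1, i] @ b)" using u(4) run by simp
    also have "braid_eq \<dots> ((u @ a) @ [i - 1, i, i - 1] @ b)"
      by (rule braid_move_eq) (use braid_move.braid_back[of "i - 1"] i in simp)
    also have "braid_eq \<dots> (u @ [i - 1] @ rev [t..<q + 2])"
    proof -
      have "\<forall>j\<in>set a. i - 1 + 2 \<le> j" using i by (auto simp: a_def simp del: upt_Suc)
      then have "braid_eq (a @ [i - 1]) ((i - 1) # a)"
        by (intro braid_eq_sym[OF commute_right]) blast
      from braid_eq_ctx[OF this, of u "[i, i - 1] @ b"] show ?thesis using run by simp
    qed
    finally show ?thesis using trans inner[of "i - 1"] 4 u(2) \<open>i < Suc (Suc q)\<close> by simp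
  qed
qed auto

lemma ex_run_word:
  "is_word r w \<Longrightarrow> \<exists>v. braid_eq w v \<and> (run_word r v \<or> (\<exists>x j y. v = x @ [j, j] @ y))"
proof (induction w rule: rev_induct)
  case Nil
  then show ?case using run_word_Nil by blast
next
  case (snoc i w)
  then obtain v where v: "braid_eq w v" "run_word r v \<or> (\<exists>x j y. v = x @ [j, j] @ y)"
    by (auto simp: is_word_def)
  have 1: "braid_eq (w @ [i]) (v @ [i])" using v(1) by (rule braid_eq_append)
  from v(2) show ?case
  proof
    assume "run_word r v"
    moreover have "1 \<le> i" "i < r" using snoc.prems by (auto simp: is_word_def)
    ultimately show ?thesis using run_word_snoc[of r v i] 1 braid_eq_trans by blast
  next
    assume "\<exists>x j y. v = x @ [j, j] @ y"
    then obtain x j y where "v @ [i] = x @ [j, j] @ (y @ [i])" by auto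
    then show ?thesis using 1 by blast
  qed
qed

lemma word_perm_fix: "\<forall>i\<in>set w. Suc i < k \<Longrightarrow> word_perm w k = k"
  by (induction w) (auto simp: transpose_def)

lemma word_perm_run: "t \<le> q \<Longrightarrow> word_perm (rev [t..<q]) t = q"
proof (induction "q - t" arbitrary: t)
  case (Suc d)
  then have "[t..<q] = t # [Suc t..<q]" using upt_conv_Cons by simp
  then show ?case using Suc by (simp add: word_perm_append)
qed simp

lemma bij_word_perm: "bij (word_perm w)"
proof (induction w)
  case (Cons i w)
  then show ?case unfolding word_perm.simps by (intro bij_comp) simp_all
qed (simp only: word_perm.simps bij_id)

lemma inj_word_perm: "inj (word_perm w)"
  using bij_word_perm by (rule bij_is_inj)

text \<open>The lower end \<open>t\<close> of the last run can be read off the permutation as the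
  preimage of \<open>q + 2\<close>: the run carries \<open>t\<close> there, and the earlier runs fix
  that point. Cancelling the common run leaves shorter normal forms.\<close>

lemma run_word_unique: "run_word r u \<Longrightarrow> run_word r v \<Longrightarrow> word_perm u = word_perm v \<Longrightarrow> u = v"
proof (induction r u arbitrary: v rule: run_word.induct)
  case (3 q w)
  obtain u t where u: "run_word (Suc q) u" "t \<le> q + 2" "w = u @ rev [t..<q + 2]"
    using 3 by auto
  obtain u' t' where u': "run_word (Suc q) u'" "t' \<le> q + 2" "v = u' @ rev [t'..<q + 2]"
    using 3 by auto
  have fixed: "word_perm z (q + 2) = q + 2" if "run_word (Suc q) z" for z
    using run_word_is_word[OF that] by (intro word_perm_fix) (auto simp: is_word_def)
  have "word_perm w t = q + 2" "word_perm v t' = q + 2"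
    unfolding u(3) u'(3) word_perm_append comp_apply
      word_perm_run[OF u(2)] word_perm_run[OF u'(2)] fixed[OF u(1)] fixed[OF u'(1)] by (simp_all only:)
  then have t: "t = t'" using "3.prems"(3) inj_word_perm[of v] by (metis injD)
  have "word_perm u \<circ> word_perm (rev [t..<q + 2]) = word_perm u' \<circ> word_perm (rev [t..<q + 2])"
    using "3.prems"(3) u(3) u'(3) t by (simp only: word_perm_append)
  then have "word_perm u = word_perm u'"
    using surj_fun_eq[OF bij_is_surj[OF bij_word_perm], of "word_perm u" "rev [t..<q + 2]" "word_perm u'"]
    by (simp only: fun_eq_iff comp_apply) blast
  then show ?case using "3.IH"[OF u(1) u'(1)] u u' t by simp
qed auto

lemma reduced_no_square: "reduced r (x @ [j, j] @ y) \<Longrightarrow> False"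
proof -
  assume red: "reduced r (x @ [j, j] @ y)"
  have "word_perm (x @ y) = word_perm (x @ [j, j] @ y)"
    by (simp add: word_perm_append fun_eq_iff)
  moreover have "is_word r (x @ y)" using red by (auto simp: reduced_def is_word_def)
  ultimately have "length (x @ [j, j] @ y) \<le> length (x @ y)" using red unfolding reduced_def by blast
  then show False by simp
qed

lemma reduced_cong: "braid_eq u v \<Longrightarrow> reduced r u \<Longrightarrow> reduced r v"
  using braid_eq_perm[of u v] braid_eq_length[of u v] braid_eq_is_word[of u v r]
  by (simp add: reduced_def)

lemma word_perm_permutes: "is_word r w \<Longrightarrow> word_perm w permutes {1..r}"
proof (induction w)
  case (Cons i w)
  then have "transpose i (i + 1) permutes {1..r}" "word_perm w permutes {1..r}"
    by (auto simp: is_word_def intro: permutes_swap_id)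
  then show ?case unfolding word_perm.simps by (rule permutes_compose[rotated])
qed (simp add: permutes_id)

text \<open>Both \<open>w\<close> and the chosen word for its permutation are brought to products of
  runs. The chosen word cannot show a square on the way because braid moves keep it reduced, so the
  two products agree by uniqueness and the two words are joined through them.\<close>

lemma matsumoto:
  assumes "admissible_H HH" and "is_word r w"
  shows "\<exists>v. braid_eq w v \<and> (v \<in> HH r \<or> (\<exists>x j y. v = x @ [j, j] @ y))"
proof -
  obtain v where v: "braid_eq w v" "run_word r v \<or> (\<exists>x j y. v = x @ [j, j] @ y)"
    using ex_run_word[OF assms(2)] by blast
  from v(2) show ?thesis
  proof
    assume run: "run_word r v"
    obtain h where h: "h \<in> HH r" "word_perm h = word_perm w" "reduced r h"
      using assms word_perm_permutes[OF assms(2)] unfolding admissible_H_def by blast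
    obtain h' where h': "braid_eq h h'" "run_word r h' \<or> (\<exists>x j y. h' = x @ [j, j] @ y)"
      using ex_run_word[of r h] h(3) unfolding reduced_def by blast
    have "reduced r h'" using reduced_cong h' h(3) by blast
    then have "run_word r h'" using h'(2) reduced_no_square by blast
    moreover have "word_perm h' = word_perm v"
      using braid_eq_perm h'(1) v(1) h(2) by metis
    ultimately have "h' = v" using run_word_unique run by blast
    then have "braid_eq w h" using v(1) h'(1) braid_eq_sym braid_eq_trans by blast
    then show ?thesis using h(1) by blast
  qed (use v(1) in blast)
qed

section \<open>Soundness of simplification\<close>

declare eq_in_C.trans [trans]

lemma arr_layer_mor: "arr (layer_mor x) (ldom x) (lcod x)"
proof (cases x)
  case (Layer l g r)
  have "arr (Id l \<boxtimes> Gen g \<boxtimes> Id r) (l + (gdom g + r)) (l + (gcod g + r))"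
    by (intro arr.intros)
  then show ?thesis using Layer by (simp add: add.assoc)
qed

lemma arr_diagram_mor: "is_diagram m n w \<Longrightarrow> arr (diagram_mor m w :: 'k mor) m n"
proof (induction w arbitrary: n)
  case (Cons x w)
  then have "arr (layer_mor x \<odot> diagram_mor m w :: 'k mor) m (lcod x)"
    by (intro arr.intros(3)[OF arr_layer_mor]) auto
  then show ?case using Cons.prems by simp
qed (auto intro: arr.intros)

lemma arr_lincomb_mor:
  "\<forall>(c, v)\<in>set R. is_diagram m n v \<Longrightarrow> arr (lincomb_mor m n R) m n"
  by (induction R) (auto intro!: arr.intros arr_diagram_mor)

text \<open>The interchange law is available only where the two inner factors are homogeneous, so a
  parity is needed before identity strands can be added to a composite.\<close>

lemma homog_diagram_mor: "\<exists>p. homog P (diagram_mor m w) p"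
proof (induction w)
  case (Cons x w)
  then obtain p where p: "homog P (diagram_mor m w) p" by blast
  obtain l g r where x: "x = Layer l g r" by (cases x)
  have "homog P (Id l \<boxtimes> Gen g \<boxtimes> Id r) (False \<noteq> (godd P g \<noteq> False))" by (intro homog.intros)
  then show ?case using homog.intros(3)[OF _ p, of "layer_mor x"] x by auto
qed (auto intro: homog.intros)

lemma is_diagram_append:
  "is_diagram m n (x @ y) \<longleftrightarrow> (\<exists>k. is_diagram k n x \<and> is_diagram m k y)"
  by (induction x arbitrary: n) auto

lemma diagram_mor_append:
  assumes "is_diagram k n x" "is_diagram m k y"
  shows "eq_in_C P m n (diagram_mor m (x @ y)) (diagram_mor k x \<odot> diagram_mor m y)"
  using assms(1)
proof (induction x arbitrary: n)
  case Nil
  then show ?case using arr_diagram_mor[OF assms(2)] by (auto intro: eq_in_C.sym eq_in_C.id_comp)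
next
  case (Cons a x)
  then have a: "lcod a = n" and x: "is_diagram k (ldom a) x" by auto
  have la: "arr (layer_mor a) (ldom a) n" using arr_layer_mor a by blast
  have "eq_in_C P m n (layer_mor a \<odot> diagram_mor m (x @ y))
      (layer_mor a \<odot> (diagram_mor k x \<odot> diagram_mor m y))"
    by (rule eq_in_C.comp_cong[OF eq_in_C.refl[OF la] Cons.IH[OF x]])
  also have "eq_in_C P m n \<dots> ((layer_mor a \<odot> diagram_mor k x) \<odot> diagram_mor m y)"
    by (rule eq_in_C.sym, rule eq_in_C.comp_assoc[OF la]) (use x assms(2) in \<open>auto intro: arr_diagram_mor\<close>)
  finally show ?case by simp
qed

lemma whisker_append [simp]: "whisker l r (x @ y) = whisker l r x @ whisker l r y"
  and whisker_simps [simp]: "whisker l r [] = []"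
    "whisker l r (Layer i g j # w) = Layer (l + i) g (j + r) # whisker l r w"
  by (simp_all add: whisker_def)

lemma is_diagram_whisker: "is_diagram m n w \<Longrightarrow> is_diagram (l + m + r) (l + n + r) (whisker l r w)"
proof (induction w arbitrary: n)
  case (Cons x w)
  obtain i g j where x: "x = Layer i g j" by (cases x)
  have "is_diagram (l + m + r) (l + ldom x + r) (whisker l r w)" using Cons by simp
  then show ?case using Cons.prems x by (auto simp: ac_simps)
qed simp

section \<open>Tensoring with identity strands\<close>

lemma comp_tens:
  fixes P :: "'k::field params"
  assumes "arr f n k" "arr g n' k'" "arr h m n" "arr h' m' n'" "homog P g p" "homog P h q" "\<not> (p \<and> q)"
  shows "eq_in_C P (m + m') (k + k') ((f \<boxtimes> g) \<odot> (h \<boxtimes> h')) ((f \<odot> h) \<boxtimes> (g \<odot> h'))"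
proof -
  have "koszul p q = (1 :: 'k)" using assms(7) by (auto simp: koszul_def)
  then have "eq_in_C P (m + m') (k + k') ((f \<boxtimes> g) \<odot> (h \<boxtimes> h')) (Scale 1 ((f \<odot> h) \<boxtimes> (g \<odot> h')))"
    using eq_in_C.interchange[OF assms(1-6)] by simp
  also have "eq_in_C P (m + m') (k + k') \<dots> ((f \<odot> h) \<boxtimes> (g \<odot> h'))"
    by (intro eq_in_C.scale_1 arr.intros) (use assms in auto)
  finally show ?thesis .
qed

abbreviation pad :: "nat \<Rightarrow> nat \<Rightarrow> 'k mor \<Rightarrow> 'k mor" where
  "pad l r f \<equiv> Id l \<boxtimes> f \<boxtimes> Id r"

lemma arr_pad: "arr f m n \<Longrightarrow> arr (pad l r f) (l + m + r) (l + n + r)"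
  using arr.intros(4)[OF arr.intros(1)[of l] arr.intros(4)[OF _ arr.intros(1)[of r], of f m n]]
  by (simp add: add.assoc)

lemma pad_cong: "eq_in_C P m n f g \<Longrightarrow> eq_in_C P (l + m + r) (l + n + r) (pad l r f) (pad l r g)"
  using eq_in_C.tens_cong[OF eq_in_C.refl[OF arr.intros(1)[of l]]
      eq_in_C.tens_cong[OF _ eq_in_C.refl[OF arr.intros(1)[of r]], of P m n f g]]
  by (simp add: add.assoc)

text \<open>In both uses of the interchange law one of the two factors that determine the sign is an
  identity, hence even, so no sign appears.\<close>

lemma pad_comp:
  assumes f: "arr f n k" and g: "arr g m n" and q: "homog P f p" "homog P g q"
  shows "eq_in_C P (l + m + r) (l + k + r) (pad l r f \<odot> pad l r g) (pad l r (f \<odot> g))"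
proof -
  note Id = arr.intros(1)
  have 1: "eq_in_C P (m + r) (k + r) ((f \<boxtimes> Id r) \<odot> (g \<boxtimes> Id r)) ((f \<odot> g) \<boxtimes> (Id r \<odot> Id r))"
    by (rule comp_tens[OF f Id g Id homog.intros(1) q(2)]) simp
  have 2: "eq_in_C P (m + r) (k + r) ((f \<odot> g) \<boxtimes> (Id r \<odot> Id r)) ((f \<odot> g) \<boxtimes> Id r)"
    by (intro eq_in_C.tens_cong eq_in_C.refl eq_in_C.id_comp arr.intros(3)[OF f g] Id)
  have 3: "eq_in_C P (l + (m + r)) (l + (k + r)) (pad l r f \<odot> pad l r g)
      ((Id l \<odot> Id l) \<boxtimes> ((f \<boxtimes> Id r) \<odot> (g \<boxtimes> Id r)))"
    by (rule comp_tens[OF Id _ Id _ homog.intros(4)[OF q(1) homog.intros(1)] homog.intros(1)])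
       (auto intro: arr.intros f g)
  also have "eq_in_C P (l + (m + r)) (l + (k + r)) \<dots> (pad l r (f \<odot> g))"
    by (intro eq_in_C.tens_cong eq_in_C.id_comp Id eq_in_C.trans[OF 1 2])
  finally show ?thesis by (simp add: add.assoc)
qed

lemma pad_pad:
  assumes "arr f m n"
  shows "eq_in_C P (l + i + m + (j + r)) (l + i + n + (j + r)) (pad (l + i) (j + r) f) (pad l r (pad i j f))"
proof -
  note Id = arr.intros(1)
  have "eq_in_C P (l + i + (m + (j + r))) (l + i + (n + (j + r)))
      (Id (l + i) \<boxtimes> f \<boxtimes> Id (j + r)) ((Id l \<boxtimes> Id i) \<boxtimes> f \<boxtimes> (Id j \<boxtimes> Id r))"
    by (intro eq_in_C.tens_cong eq_in_C.refl assms eq_in_C.sym[OF eq_in_C.id_tens_id])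
  also have "eq_in_C P (l + i + (m + (j + r))) (l + i + (n + (j + r)))
      \<dots> (Id l \<boxtimes> Id i \<boxtimes> f \<boxtimes> (Id j \<boxtimes> Id r))"
    by (intro eq_in_C.tens_assoc arr.intros assms)
  also have "eq_in_C P (l + i + (m + (j + r))) (l + i + (n + (j + r)))
      \<dots> (Id l \<boxtimes> Id i \<boxtimes> ((f \<boxtimes> Id j) \<boxtimes> Id r))"
    using eq_in_C.tens_cong[OF eq_in_C.refl[OF Id[of l]] eq_in_C.tens_cong[OF eq_in_C.refl[OF Id[of i]]
        eq_in_C.sym[OF eq_in_C.tens_assoc[OF assms Id[of j] Id[of r]]]], of P]
    by (simp add: add.assoc)
  also have "eq_in_C P (l + i + (m + (j + r))) (l + i + (n + (j + r)))
      \<dots> (pad l r (pad i j f))"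
    using eq_in_C.tens_cong[OF eq_in_C.refl[OF Id[of l]]
        eq_in_C.sym[OF eq_in_C.tens_assoc[OF Id[of i] arr.intros(4)[OF assms Id[of j]] Id[of r]]], of P]
    by (simp add: add.assoc)
  finally show ?thesis by (simp add: add.assoc)
qed

lemma pad_Id: "eq_in_C P (l + m + r) (l + m + r) (pad l r (Id m)) (Id (l + m + r))"
proof -
  have "eq_in_C P (l + (m + r)) (l + (m + r)) (pad l r (Id m)) (Id l \<boxtimes> Id (m + r))"
    by (intro eq_in_C.tens_cong eq_in_C.refl eq_in_C.id_tens_id arr.intros(1))
  also have "eq_in_C P (l + (m + r)) (l + (m + r)) \<dots> (Id (l + (m + r)))"
    by (rule eq_in_C.id_tens_id)
  finally show ?thesis by (simp add: add.assoc)
qed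

lemma diagram_mor_whisker:
  "is_diagram m n w \<Longrightarrow>
    eq_in_C P (l + m + r) (l + n + r) (diagram_mor (l + m + r) (whisker l r w)) (pad l r (diagram_mor m w))"
proof (induction w arbitrary: n)
  case Nil
  then show ?case using eq_in_C.sym[OF pad_Id] by simp
next
  case (Cons x w)
  obtain i g j where x: "x = Layer i g j" by (cases x)
  have w: "is_diagram m (ldom x) w" and n: "n = i + gcod g + j" using Cons.prems x by auto
  have hx: "homog P (layer_mor x) (False \<noteq> (godd P g \<noteq> False))"
    unfolding x layer_mor.simps by (intro homog.intros)
  obtain q where hw: "homog P (diagram_mor m w) q" using homog_diagram_mor by blast
  have "eq_in_C P (l + ldom x + r) (l + n + r) (pad (l + i) (j + r) (Gen g)) (pad l r (layer_mor x))"
    using pad_pad[OF arr.intros(2)[of g], of P l i j r] x n by (simp add: ac_simps)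
  from eq_in_C.comp_cong[OF this Cons.IH[OF w]]
  have "eq_in_C P (l + m + r) (l + n + r) (diagram_mor (l + m + r) (whisker l r (x # w)))
     (pad l r (layer_mor x) \<odot> pad l r (diagram_mor m w))"
    using x by simp
  also have "eq_in_C P (l + m + r) (l + n + r) \<dots> (pad l r (layer_mor x \<odot> diagram_mor m w))"
    by (rule pad_comp[OF _ arr_diagram_mor[OF w] hx hw]) (use arr_layer_mor[of x] Cons.prems in simp)
  finally show ?case by simp
qed

lemma defrel_diagram:
  "defrel P m n w R \<Longrightarrow> is_diagram m n w \<and> (\<forall>(c, v)\<in>set R. is_diagram m n v)"
  by (induction rule: defrel.induct) auto

lemma Scale_1_Zero: "arr f m n \<Longrightarrow> eq_in_C P m n (Scale 1 f \<boxplus> Zero m n) f"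
  by (meson arr.intros(7) eq_in_C.add_zero eq_in_C.scale_1 eq_in_C.trans)

lemma lincomb_single:
  assumes "is_diagram m n v" "eq_in_C P m n f (Scale c (diagram_mor m v))"
  shows "eq_in_C P m n f (lincomb_mor m n [(c, v)])"
  using assms(2) eq_in_C.sym[OF eq_in_C.add_zero[OF arr.intros(7)[OF arr_diagram_mor[OF assms(1)], of c]], of P]
  by (auto intro: eq_in_C.trans)

lemma two_layers:
  "eq_in_C P (ldom y) (lcod x) (diagram_mor (ldom y) [x, y]) (layer_mor x \<odot> layer_mor y)"
  if "ldom x = lcod y"
proof -
  have "eq_in_C P (ldom y) (ldom x) (layer_mor y \<odot> Id (ldom y)) (layer_mor y)"
    unfolding that by (intro eq_in_C.comp_id arr_layer_mor)
  then show ?thesis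
    unfolding diagram_mor.simps by (rule eq_in_C.comp_cong[OF eq_in_C.refl[OF arr_layer_mor]])
qed

lemma first_layer:
  "eq_in_C P (gdom g + (k + d)) (gcod g + (k + d)) (layer_mor (Layer 0 g (k + d))) (Gen g \<boxtimes> Id k \<boxtimes> Id d)"
proof -
  note Id = arr.intros(1) and Gen = arr.intros(2)
  have "eq_in_C P (gdom g + (k + d)) (gcod g + (k + d)) (layer_mor (Layer 0 g (k + d))) (Gen g \<boxtimes> Id (k + d))"
    by (simp, intro eq_in_C.unit_tens arr.intros(4) Gen Id)
  also have "eq_in_C P (gdom g + (k + d)) (gcod g + (k + d)) \<dots> (Gen g \<boxtimes> Id k \<boxtimes> Id d)"
    by (intro eq_in_C.tens_cong eq_in_C.refl Gen eq_in_C.sym[OF eq_in_C.id_tens_id])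
  finally show ?thesis .
qed

lemma last_layer:
  "eq_in_C P (d + (k + gdom h)) (d + (k + gcod h)) (layer_mor (Layer (d + k) h 0)) (Id d \<boxtimes> Id k \<boxtimes> Gen h)"
proof -
  note Id = arr.intros(1) and Gen = arr.intros(2)
  have "eq_in_C P (d + k + gdom h) (d + k + gcod h) (layer_mor (Layer (d + k) h 0)) ((Id d \<boxtimes> Id k) \<boxtimes> Gen h)"
    by (simp, intro eq_in_C.tens_cong eq_in_C.tens_unit Gen eq_in_C.sym[OF eq_in_C.id_tens_id])
  also have "eq_in_C P (d + k + gdom h) (d + k + gcod h) \<dots> (Id d \<boxtimes> Id k \<boxtimes> Gen h)"
    by (intro eq_in_C.tens_assoc Id Gen)
  finally show ?thesis by (simp add: add.assoc)
qed

text \<open>Both composites are compared with the tensor product of \<open>g\<close>,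
  \<open>k\<close> strands and \<open>h\<close>. Only when \<open>h\<close> is above
  \<open>g\<close> do two possibly odd factors pass each other, so the whole sign sits in the second
  equation.\<close>

lemma interchange_layers:
  fixes P :: "'k::field params"
  defines "m \<equiv> \<lambda>g k h. gdom g + (k + gdom h)" and "n \<equiv> \<lambda>g k h. gcod g + (k + gcod h)"
  shows "eq_in_C P (m g k h) (n g k h)
      (diagram_mor (m g k h) [Layer 0 g (k + gcod h), Layer (gdom g + k) h 0])
      (Gen g \<boxtimes> Id k \<boxtimes> Gen h)" (is ?a)
    and "eq_in_C P (m g k h) (n g k h)
      (diagram_mor (m g k h) [Layer (gcod g + k) h 0, Layer 0 g (k + gdom h)])
      (Scale (koszul (godd P g) (godd P h)) (Gen g \<boxtimes> Id k \<boxtimes> Gen h))" (is ?b)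
proof -
  note Id = arr.intros(1) and Gen = arr.intros(2) and hId = homog.intros(1) and hGen = homog.intros(2)
  let ?m = "m g k h" and ?n = "n g k h"
  have gcomp: "eq_in_C P (gdom g) (gcod g) (Gen g \<odot> Id (gdom g)) (Gen g)"
    "eq_in_C P (gdom g) (gcod g) (Id (gcod g) \<odot> Gen g) (Gen g)" for g
    by (intro eq_in_C.comp_id eq_in_C.id_comp Gen)+
  have kk: "eq_in_C P k k (Id k \<odot> Id k) (Id k)" by (intro eq_in_C.id_comp Id)
  have odd: "homog P (Id k \<boxtimes> Gen h) (godd P h)"
    using homog.intros(4)[OF hId[of P k] hGen[of P h]] by simp
  have "eq_in_C P ?m ?n (diagram_mor ?m [Layer 0 g (k + gcod h), Layer (gdom g + k) h 0])
      (layer_mor (Layer 0 g (k + gcod h)) \<odot> layer_mor (Layer (gdom g + k) h 0))"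
    using two_layers[of "Layer 0 g (k + gcod h)" "Layer (gdom g + k) h 0" P]
    by (simp add: m_def n_def add.assoc)
  also have "eq_in_C P ?m ?n \<dots> ((Gen g \<boxtimes> Id k \<boxtimes> Id (gcod h)) \<odot> (Id (gdom g) \<boxtimes> Id k \<boxtimes> Gen h))"
    unfolding m_def n_def by (rule eq_in_C.comp_cong[OF first_layer last_layer])
  also have "eq_in_C P ?m ?n \<dots> ((Gen g \<odot> Id (gdom g)) \<boxtimes> ((Id k \<boxtimes> Id (gcod h)) \<odot> (Id k \<boxtimes> Gen h)))"
    unfolding m_def n_def
    by (rule comp_tens[OF Gen _ Id _ homog.intros(4)[OF hId hId] hId]) (auto intro: arr.intros)
  also have "eq_in_C P ?m ?n \<dots> (Gen g \<boxtimes> Id k \<boxtimes> Gen h)"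
    unfolding m_def n_def
  proof (rule eq_in_C.tens_cong[OF gcomp(1)])
    have "eq_in_C P (k + gdom h) (k + gcod h) ((Id k \<boxtimes> Id (gcod h)) \<odot> (Id k \<boxtimes> Gen h))
      ((Id k \<odot> Id k) \<boxtimes> (Id (gcod h) \<odot> Gen h))"
      by (rule comp_tens[OF Id Id Id Gen hId hId]) simp
    also have "eq_in_C P (k + gdom h) (k + gcod h) \<dots> (Id k \<boxtimes> Gen h)"
      by (rule eq_in_C.tens_cong[OF kk gcomp(2)])
    finally show "eq_in_C P (k + gdom h) (k + gcod h) ((Id k \<boxtimes> Id (gcod h)) \<odot> (Id k \<boxtimes> Gen h)) (Id k \<boxtimes> Gen h)" .
  qed
  finally show ?a .
  have "eq_in_C P ?m ?n (diagram_mor ?m [Layer (gcod g + k) h 0, Layer 0 g (k + gdom h)])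
      (layer_mor (Layer (gcod g + k) h 0) \<odot> layer_mor (Layer 0 g (k + gdom h)))"
    using two_layers[of "Layer (gcod g + k) h 0" "Layer 0 g (k + gdom h)" P]
    by (simp add: m_def n_def add.assoc)
  also have "eq_in_C P ?m ?n \<dots> ((Id (gcod g) \<boxtimes> Id k \<boxtimes> Gen h) \<odot> (Gen g \<boxtimes> Id k \<boxtimes> Id (gdom h)))"
    unfolding m_def n_def by (rule eq_in_C.comp_cong[OF last_layer first_layer])
  also have "eq_in_C P ?m ?n \<dots> (Scale (koszul (godd P h) (godd P g))
      ((Id (gcod g) \<odot> Gen g) \<boxtimes> ((Id k \<boxtimes> Gen h) \<odot> (Id k \<boxtimes> Id (gdom h)))))"
    unfolding m_def n_def
    by (rule eq_in_C.interchange[OF Id _ Gen _ odd hGen]) (auto intro: arr.intros)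
  also have "koszul (godd P h) (godd P g) = (koszul (godd P g) (godd P h) :: 'k)"
    by (auto simp: koszul_def)
  also have "eq_in_C P ?m ?n (Scale (koszul (godd P g) (godd P h))
      ((Id (gcod g) \<odot> Gen g) \<boxtimes> ((Id k \<boxtimes> Gen h) \<odot> (Id k \<boxtimes> Id (gdom h)))))
      (Scale (koszul (godd P g) (godd P h)) (Gen g \<boxtimes> Id k \<boxtimes> Gen h))"
    unfolding m_def n_def
  proof (rule eq_in_C.scale_cong[OF eq_in_C.tens_cong[OF gcomp(2)]])
    have "eq_in_C P (k + gdom h) (k + gcod h) ((Id k \<boxtimes> Gen h) \<odot> (Id k \<boxtimes> Id (gdom h)))
      ((Id k \<odot> Id k) \<boxtimes> (Gen h \<odot> Id (gdom h)))"
      by (rule comp_tens[OF Id Gen Id Id hGen hId]) simp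
    also have "eq_in_C P (k + gdom h) (k + gcod h) \<dots> (Id k \<boxtimes> Gen h)"
      by (rule eq_in_C.tens_cong[OF kk gcomp(1)])
    finally show "eq_in_C P (k + gdom h) (k + gcod h) ((Id k \<boxtimes> Gen h) \<odot> (Id k \<boxtimes> Id (gdom h))) (Id k \<boxtimes> Gen h)" .
  qed
  finally show ?b .
qed

text \<open>Nonemptiness of \<open>w\<close> is included because only a nonempty word determines its
  type; this fixes the types of the surrounding pieces when a rule is applied inside a
  diagram.\<close>

lemma local_rule_sound:
  fixes P :: "'k::field params"
  assumes "local_rule P w R"
  shows "w \<noteq> [] \<and> (\<exists>m n. is_diagram m n w \<and> (\<forall>(c, v)\<in>set R. is_diagram m n v) \<and>
    eq_in_C P m n (diagram_mor m w) (lincomb_mor m n R))"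
  using assms
proof cases
  case (relation m n)
  moreover have "w \<noteq> []" using relation by cases auto
  ultimately show ?thesis using defrel_diagram eq_in_C.relation by blast
next
  case braid_back
  let ?b = "[Layer 0 Cross 1, Layer 1 Cross 0, Layer 0 Cross 1]"
  have w: "is_diagram 3 3 w" "is_diagram 3 3 ?b" unfolding braid_back by simp_all
  have "eq_in_C P 3 3 (diagram_mor 3 ?b) (lincomb_mor 3 3 [(1, w)])"
    using eq_in_C.relation[OF defrel.braid[of P]] braid_back by simp
  also have "eq_in_C P 3 3 \<dots> (diagram_mor 3 w)"
    using Scale_1_Zero[OF arr_diagram_mor[OF w(1)], of P] by simp
  finally have "eq_in_C P 3 3 (diagram_mor 3 w) (diagram_mor 3 ?b)" by (rule eq_in_C.sym)
  also have "eq_in_C P 3 3 \<dots> (lincomb_mor 3 3 R)"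
    using eq_in_C.sym[OF Scale_1_Zero[OF arr_diagram_mor[OF w(2)], of P]] braid_back by simp
  finally show ?thesis using w braid_back by (intro conjI exI[of _ 3]) auto
next
  case (interchange g k h)
  let ?m = "gdom g + (k + gdom h)" and ?n = "gcod g + (k + gcod h)" and ?T = "Gen g \<boxtimes> Id k \<boxtimes> Gen h :: 'k mor"
  let ?c = "koszul (godd P g) (godd P h) :: 'k" and ?v = "[Layer (gcod g + k) h 0, Layer 0 g (k + gdom h)]"
  have T: "arr ?T ?m ?n" by (intro arr.intros)
  have v: "is_diagram ?m ?n ?v" and w: "is_diagram ?m ?n w" using interchange by (simp_all add: add.assoc)
  \<comment> \<open>The sign is its own inverse and may change sides, which reduces this direction
    to the same two comparisons as the opposite one.\<close>
  have cc: "?c * ?c = 1" by (simp add: koszul_def)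
  have "eq_in_C P ?m ?n (Scale ?c (diagram_mor ?m ?v)) (Scale ?c (Scale ?c ?T))"
    by (rule eq_in_C.scale_cong[OF interchange_layers(2)])
  also have "eq_in_C P ?m ?n \<dots> (Scale (?c * ?c) ?T)" by (rule eq_in_C.scale_scale[OF T])
  also have "eq_in_C P ?m ?n \<dots> ?T" unfolding cc by (rule eq_in_C.scale_1[OF T])
  finally have "eq_in_C P ?m ?n (diagram_mor ?m w) (Scale ?c (diagram_mor ?m ?v))"
    unfolding interchange(1) by (meson interchange_layers(1) eq_in_C.sym eq_in_C.trans)
  from lincomb_single[OF v this] show ?thesis
    using v w interchange by (intro conjI exI[of _ ?m] exI[of _ ?n]) auto
next
  case (interchange_back g k h)
  let ?m = "gdom g + (k + gdom h)" and ?n = "gcod g + (k + gcod h)" and ?T = "Gen g \<boxtimes> Id k \<boxtimes> Gen h :: 'k mor"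
  let ?c = "koszul (godd P g) (godd P h) :: 'k" and ?v = "[Layer 0 g (k + gcod h), Layer (gdom g + k) h 0]"
  have v: "is_diagram ?m ?n ?v" and w: "is_diagram ?m ?n w" using interchange_back by (simp_all add: add.assoc)
  have "eq_in_C P ?m ?n (Scale ?c ?T) (Scale ?c (diagram_mor ?m ?v))"
    by (rule eq_in_C.scale_cong[OF eq_in_C.sym[OF interchange_layers(1)]])
  with interchange_layers(2) have "eq_in_C P ?m ?n (diagram_mor ?m w) (Scale ?c (diagram_mor ?m ?v))"
    unfolding interchange_back(1) by (rule eq_in_C.trans)
  from lincomb_single[OF v this] show ?thesis
    using v w interchange_back by (intro conjI exI[of _ ?m] exI[of _ ?n]) auto
qed

section \<open>From single relations to linear combinations in context\<close>

lemma linear_lincomb_mor: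
  assumes cong: "\<And>f g. eq_in_C P m n f g \<Longrightarrow> eq_in_C P m' n' (F f) (F g)"
    and add: "\<And>f g. arr f m n \<Longrightarrow> arr g m n \<Longrightarrow> eq_in_C P m' n' (F (f \<boxplus> g)) (F f \<boxplus> F g)"
    and scale: "\<And>c f. arr f m n \<Longrightarrow> eq_in_C P m' n' (F (Scale c f)) (Scale c (F f))"
    and F: "\<And>f. arr f m n \<Longrightarrow> arr (F f) m' n'"
    and img: "\<And>c v. (c, v) \<in> set R \<Longrightarrow> is_diagram m n v"
      "\<And>c v. (c, v) \<in> set R \<Longrightarrow> eq_in_C P m' n' (F (diagram_mor m v)) (diagram_mor m' (\<psi> v))"
      "\<And>c v. (c, v) \<in> set R \<Longrightarrow> is_diagram m' n' (\<psi> v)"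
  shows "eq_in_C P m' n' (F (lincomb_mor m n R)) (lincomb_mor m' n' (map (\<lambda>(c, v). (c, \<psi> v)) R))"
  using img
proof (induction R)
  case Nil
  have Z: "arr (Zero m n) m n" by (rule arr.intros)
  \<comment> \<open>No law states directly that composition or tensoring sends zero to zero; it
    follows by writing zero as 0 times zero and pulling out the scalar.\<close>
  have "eq_in_C P m' n' (F (Zero m n)) (F (Scale 0 (Zero m n)))"
    by (intro cong eq_in_C.sym[OF eq_in_C.scale_0] Z)
  also have "eq_in_C P m' n' \<dots> (Scale 0 (F (Zero m n)))"
    by (rule scale[OF Z])
  also have "eq_in_C P m' n' \<dots> (Zero m' n')" by (intro eq_in_C.scale_0 F Z)
  finally show ?case by simp
next
  case (Cons a R)
  obtain c v where a: "a = (c, v)" by force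
  have v: "arr (diagram_mor m v) m n" using Cons.prems a by (auto intro: arr_diagram_mor)
  have R: "arr (lincomb_mor m n R) m n" using Cons.prems by (auto intro: arr_lincomb_mor)
  have "eq_in_C P m' n' (F (lincomb_mor m n (a # R))) (F (Scale c (diagram_mor m v)) \<boxplus> F (lincomb_mor m n R))"
    using add[OF arr.intros(7)[OF v] R] a by simp
  also have "eq_in_C P m' n' \<dots> (Scale c (F (diagram_mor m v)) \<boxplus> lincomb_mor m' n' (map (\<lambda>(c, v). (c, \<psi> v)) R))"
    by (intro eq_in_C.add_cong scale v Cons.IH) (blast intro: Cons.prems list.set_intros(2))+
  also have "eq_in_C P m' n' \<dots> (Scale c (diagram_mor m' (\<psi> v)) \<boxplus> lincomb_mor m' n' (map (\<lambda>(c, v). (c, \<psi> v)) R))"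
  proof (intro eq_in_C.add_cong eq_in_C.scale_cong eq_in_C.refl)
    show "eq_in_C P m' n' (F (diagram_mor m v)) (diagram_mor m' (\<psi> v))"
      by (rule Cons.prems(2)[of c]) (simp add: a)
    show "arr (lincomb_mor m' n' (map (\<lambda>(c, v). (c, \<psi> v)) R)) m' n'"
    proof (rule arr_lincomb_mor)
      have "is_diagram m' n' (\<psi> u)" if "(b, u) \<in> set R" for b u
        by (rule Cons.prems(3)[of b]) (simp add: that)
      then show "\<forall>(b, u)\<in>set (map (\<lambda>(b, u). (b, \<psi> u)) R). is_diagram m' n' u" by auto
    qed
  qed
  finally show ?case using a by simp
qed

lemma tens_pad_add:
  assumes "arr f m n" "arr g m n"
  shows "eq_in_C P (l + m + r) (l + n + r) (pad l r (f \<boxplus> g)) (pad l r f \<boxplus> pad l r g)"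
proof -
  note Id = arr.intros(1)
  have "eq_in_C P (l + (m + r)) (l + (n + r)) (pad l r (f \<boxplus> g)) (Id l \<boxtimes> (f \<boxtimes> Id r \<boxplus> g \<boxtimes> Id r))"
    by (intro eq_in_C.tens_cong eq_in_C.refl Id eq_in_C.add_tens assms)
  also have "eq_in_C P (l + (m + r)) (l + (n + r)) \<dots> (pad l r f \<boxplus> pad l r g)"
    by (intro eq_in_C.tens_add arr.intros assms)
  finally show ?thesis by (simp add: add.assoc)
qed

lemma tens_pad_scale:
  assumes "arr f m n"
  shows "eq_in_C P (l + m + r) (l + n + r) (pad l r (Scale c f)) (Scale c (pad l r f))"
proof -
  note Id = arr.intros(1)
  have "eq_in_C P (l + (m + r)) (l + (n + r)) (pad l r (Scale c f)) (Id l \<boxtimes> Scale c (f \<boxtimes> Id r))"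
    by (intro eq_in_C.tens_cong eq_in_C.refl Id eq_in_C.scale_tens assms)
  also have "eq_in_C P (l + (m + r)) (l + (n + r)) \<dots> (Scale c (pad l r f))"
    by (intro eq_in_C.tens_scale arr.intros assms)
  finally show ?thesis by (simp add: add.assoc)
qed

lemma is_diagram_unique: "is_diagram m n w \<Longrightarrow> w \<noteq> [] \<Longrightarrow> is_diagram m' n' w \<Longrightarrow> m = m' \<and> n = n'"
proof (induction w arbitrary: n n')
  case (Cons x w)
  then show ?case by (cases "w = []") auto
qed simp

lemma is_diagram_context:
  assumes "is_diagram M N (x @ whisker l r w @ y)" "is_diagram m n w" "w \<noteq> []"
  shows "is_diagram (l + n + r) N x" "is_diagram M (l + m + r) y"
    "is_diagram m n v \<Longrightarrow> is_diagram M N (x @ whisker l r v @ y)"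
proof -
  obtain k k' where k: "is_diagram k N x" "is_diagram k' k (whisker l r w)" "is_diagram M k' y"
    using assms(1) unfolding is_diagram_append by blast
  have "whisker l r w \<noteq> []" using assms(3) by (simp add: whisker_def)
  then have "k' = l + m + r" "k = l + n + r"
    using is_diagram_unique[OF k(2) _ is_diagram_whisker[OF assms(2)]] by simp_all
  then show "is_diagram (l + n + r) N x" "is_diagram M (l + m + r) y"
    "is_diagram m n v \<Longrightarrow> is_diagram M N (x @ whisker l r v @ y)"
    using k is_diagram_whisker[of m n v l r] by (auto simp: is_diagram_append)
qed

lemma local_rule_context_sound:
  fixes P :: "'k::field params"
  assumes "local_rule P w R" "is_diagram M N (x @ whisker l r w @ y)"
  shows "(\<forall>(b, v)\<in>set R. is_diagram M N (x @ whisker l r v @ y)) \<and>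
    eq_in_C P M N (diagram_mor M (x @ whisker l r w @ y))
      (lincomb_mor M N (map (\<lambda>(b, v). (b, x @ whisker l r v @ y)) R))"
proof -
  obtain m n where w: "w \<noteq> []" "is_diagram m n w" "\<forall>(c, v)\<in>set R. is_diagram m n v"
    "eq_in_C P m n (diagram_mor m w) (lincomb_mor m n R)" using local_rule_sound[OF assms(1)] by blast
  note ctx = is_diagram_context[OF assms(2) w(2,1)]
  let ?X = "diagram_mor (l + n + r) x" and ?Y = "diagram_mor M y"
  \<comment> \<open>The context becomes one linear operator on morphisms, so the equation for the
    bare relation can be transported term by term.\<close>
  define F :: "'k mor \<Rightarrow> 'k mor" where "F f = ?X \<odot> pad l r f \<odot> ?Y" for f
  have X: "arr ?X (l + n + r) N" and Y: "arr ?Y M (l + m + r)" using ctx by (auto intro: arr_diagram_mor)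
  note rX = eq_in_C.refl[OF X] and rY = eq_in_C.refl[OF Y]
  have eqF: "eq_in_C P M N (F (diagram_mor m v)) (diagram_mor M (x @ whisker l r v @ y))"
    if "is_diagram m n v" for v
  proof -
    note wv = is_diagram_whisker[OF that, of l r]
    have "is_diagram M (l + n + r) (whisker l r v @ y)" using wv ctx(2) by (auto simp: is_diagram_append)
    from diagram_mor_append[OF ctx(1) this]
    have "eq_in_C P M N (diagram_mor M (x @ whisker l r v @ y)) (?X \<odot> diagram_mor M (whisker l r v @ y))" .
    also have "eq_in_C P M N \<dots> (F (diagram_mor m v))"
      unfolding F_def
      by (rule eq_in_C.comp_cong[OF rX eq_in_C.trans[OF diagram_mor_append[OF wv ctx(2)]
            eq_in_C.comp_cong[OF diagram_mor_whisker[OF that] rY]]])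
    finally show ?thesis by (rule eq_in_C.sym)
  qed
  have "eq_in_C P M N (F (lincomb_mor m n R))
      (lincomb_mor M N (map (\<lambda>(b, v). (b, x @ whisker l r v @ y)) R))"
  proof (rule linear_lincomb_mor)
    show cong: "eq_in_C P M N (F f) (F g)" if "eq_in_C P m n f g" for f g
      unfolding F_def by (intro eq_in_C.comp_cong[OF rX] eq_in_C.comp_cong[OF _ rY] pad_cong that)
    show "eq_in_C P M N (F (f \<boxplus> g)) (F f \<boxplus> F g)" if fg: "arr f m n" "arr g m n" for f g
    proof -
      note p = arr_pad[OF fg(1), of l r] arr_pad[OF fg(2), of l r]
      have "eq_in_C P M N (F (f \<boxplus> g)) (?X \<odot> (pad l r f \<boxplus> pad l r g) \<odot> ?Y)"
        unfolding F_def by (intro eq_in_C.comp_cong[OF rX] eq_in_C.comp_cong[OF _ rY] tens_pad_add fg)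
      also have "eq_in_C P M N \<dots> (?X \<odot> (pad l r f \<odot> ?Y \<boxplus> pad l r g \<odot> ?Y))"
        by (intro eq_in_C.comp_cong[OF rX] eq_in_C.add_comp[OF p Y])
      also have "eq_in_C P M N \<dots> (F f \<boxplus> F g)"
        unfolding F_def by (rule eq_in_C.comp_add[OF X arr.intros(3)[OF p(1) Y] arr.intros(3)[OF p(2) Y]])
      finally show ?thesis .
    qed
    show "eq_in_C P M N (F (Scale c f)) (Scale c (F f))" if f: "arr f m n" for c f
    proof -
      note p = arr_pad[OF f, of l r]
      have "eq_in_C P M N (F (Scale c f)) (?X \<odot> Scale c (pad l r f) \<odot> ?Y)"
        unfolding F_def by (intro eq_in_C.comp_cong[OF rX] eq_in_C.comp_cong[OF _ rY] tens_pad_scale f)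
      also have "eq_in_C P M N \<dots> (?X \<odot> Scale c (pad l r f \<odot> ?Y))"
        by (intro eq_in_C.comp_cong[OF rX] eq_in_C.scale_comp[OF p Y])
      also have "eq_in_C P M N \<dots> (Scale c (F f))"
        unfolding F_def by (rule eq_in_C.comp_scale[OF X arr.intros(3)[OF p Y]])
      finally show ?thesis by simp
    qed
    show "arr (F f) M N" if "arr f m n" for f
      unfolding F_def by (intro arr.intros(3)[OF X] arr.intros(3)[OF _ Y] arr_pad that)
  qed (use w ctx(3) eqF in auto)
  moreover have "eq_in_C P M N (diagram_mor M (x @ whisker l r w @ y)) (F (lincomb_mor m n R))"
    using eq_in_C.sym[OF eqF[OF w(2)]]
  proof (rule eq_in_C.trans)
    show "eq_in_C P M N (F (diagram_mor m w)) (F (lincomb_mor m n R))"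
      unfolding F_def by (intro eq_in_C.comp_cong[OF rX] eq_in_C.comp_cong[OF _ rY] pad_cong w(4))
  qed
  ultimately show ?thesis using w(3) ctx(3) by (auto intro: eq_in_C.trans)
qed

abbreviation diagrams :: "nat \<Rightarrow> nat \<Rightarrow> 'k lincomb \<Rightarrow> bool" where
  "diagrams m n L \<equiv> \<forall>(c, v)\<in>set L. is_diagram m n v"

lemma lincomb_mor_append:
  "diagrams m n L \<Longrightarrow> diagrams m n L' \<Longrightarrow>
    eq_in_C P m n (lincomb_mor m n (L @ L')) (lincomb_mor m n L \<boxplus> lincomb_mor m n L')"
proof (induction L)
  case Nil
  have *: "arr (lincomb_mor m n L') m n" "arr (Zero m n) m n"
    using Nil by (auto intro: arr_lincomb_mor arr.intros)
  have "eq_in_C P m n (Zero m n \<boxplus> lincomb_mor m n L') (lincomb_mor m n L' \<boxplus> Zero m n)"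
    by (intro eq_in_C.add_comm *)
  also have "eq_in_C P m n \<dots> (lincomb_mor m n L')" by (intro eq_in_C.add_zero *)
  finally show ?case by (simp add: eq_in_C.sym)
next
  case (Cons a L)
  obtain c v where a: "a = (c, v)" by force
  have arrs: "arr (Scale c (diagram_mor m v)) m n" "arr (lincomb_mor m n L) m n" "arr (lincomb_mor m n L') m n"
    using Cons.prems a by (auto intro!: arr_lincomb_mor arr.intros arr_diagram_mor)
  have "eq_in_C P m n (lincomb_mor m n ((a # L) @ L'))
      (Scale c (diagram_mor m v) \<boxplus> (lincomb_mor m n L \<boxplus> lincomb_mor m n L'))"
    unfolding a append_Cons lincomb_mor.simps
    by (intro eq_in_C.add_cong eq_in_C.refl arrs Cons.IH) (use Cons.prems in auto)
  also have "eq_in_C P m n \<dots> (lincomb_mor m n (a # L) \<boxplus> lincomb_mor m n L')"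
    unfolding a lincomb_mor.simps by (intro eq_in_C.sym[OF eq_in_C.add_assoc] arrs)
  finally show ?case .
qed

lemma scale_lincomb_mor:
  "diagrams m n L \<Longrightarrow>
    eq_in_C P m n (Scale c (lincomb_mor m n L)) (lincomb_mor m n (map (\<lambda>(b, v). (c * b, v)) L))"
proof (induction L)
  case Nil
  have Z: "arr (Zero m n) m n" by (rule arr.intros)
  have "eq_in_C P m n (Scale c (Zero m n)) (Scale c (Scale 0 (Zero m n)))"
    by (intro eq_in_C.scale_cong eq_in_C.sym[OF eq_in_C.scale_0] Z)
  also have "eq_in_C P m n \<dots> (Scale (c * 0) (Zero m n))" by (rule eq_in_C.scale_scale[OF Z])
  also have "eq_in_C P m n \<dots> (Zero m n)" using eq_in_C.scale_0[OF Z] by simp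
  finally show ?case by simp
next
  case (Cons a L)
  obtain b v where a: "a = (b, v)" by force
  have v: "arr (diagram_mor m v) m n" and L: "arr (lincomb_mor m n L) m n"
    using Cons.prems a by (auto intro!: arr_lincomb_mor arr_diagram_mor)
  have "eq_in_C P m n (Scale c (lincomb_mor m n (a # L)))
      (Scale c (Scale b (diagram_mor m v)) \<boxplus> Scale c (lincomb_mor m n L))"
    unfolding a lincomb_mor.simps by (intro eq_in_C.scale_add arr.intros v L)
  also have "eq_in_C P m n \<dots> (Scale (c * b) (diagram_mor m v) \<boxplus> lincomb_mor m n (map (\<lambda>(b, v). (c * b, v)) L))"
    by (intro eq_in_C.add_cong eq_in_C.scale_scale v Cons.IH) (use Cons.prems in auto)
  finally show ?case by (simp add: a)
qed

lemma simp_step_sound: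
  assumes "simp_step P L L'" "diagrams m n L"
  shows "diagrams m n L' \<and> eq_in_C P m n (lincomb_mor m n L) (lincomb_mor m n L')"
  using assms(1)
proof cases
  case (1 w R L1 c x l r y L2)
  let ?w = "x @ whisker l r w @ y"
  let ?R = "map (\<lambda>(b, v). (b, x @ whisker l r v @ y)) R"
  let ?cR = "map (\<lambda>(b, v). (c * b, x @ whisker l r v @ y)) R"
  have w: "is_diagram m n ?w" and L: "diagrams m n L1" "diagrams m n L2" "diagrams m n ((c, ?w) # L2)"
    using assms(2) 1 by auto
  note sound = local_rule_context_sound[OF 1(3) w]
  have R: "diagrams m n ?R" "diagrams m n ?cR" using sound by auto
  note arrs = arr_lincomb_mor[OF L(1)] arr_lincomb_mor[OF L(2)]
  have "eq_in_C P m n (Scale c (diagram_mor m ?w)) (Scale c (lincomb_mor m n ?R))"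
    by (rule eq_in_C.scale_cong) (use sound in blast)
  also have "eq_in_C P m n \<dots> (lincomb_mor m n ?cR)"
    using scale_lincomb_mor[OF R(1), of P c] by (simp add: case_prod_beta' comp_def)
  finally have step: "eq_in_C P m n (Scale c (diagram_mor m ?w)) (lincomb_mor m n ?cR)" .
  have "eq_in_C P m n (lincomb_mor m n L) (lincomb_mor m n L1 \<boxplus> lincomb_mor m n ((c, ?w) # L2))"
    unfolding 1(1) by (rule lincomb_mor_append[OF L(1,3)])
  also have "eq_in_C P m n \<dots> (lincomb_mor m n L1 \<boxplus> (lincomb_mor m n ?cR \<boxplus> lincomb_mor m n L2))"
    unfolding lincomb_mor.simps by (intro eq_in_C.add_cong eq_in_C.refl arrs step)
  also have "eq_in_C P m n \<dots> (lincomb_mor m n L1 \<boxplus> lincomb_mor m n (?cR @ L2))"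
    by (intro eq_in_C.add_cong[OF eq_in_C.refl[OF arrs(1)]] eq_in_C.sym[OF lincomb_mor_append] R L)
  also have "eq_in_C P m n \<dots> (lincomb_mor m n L')"
    unfolding 1(2) by (intro eq_in_C.sym[OF lincomb_mor_append]) (use L R in auto)
  finally show ?thesis using L R 1(2) by auto
qed

lemma simplifies_to_sound:
  assumes "simplifies_to P L L'" "diagrams m n L"
  shows "diagrams m n L' \<and> eq_in_C P m n (lincomb_mor m n L) (lincomb_mor m n L')"
  using assms
proof (induction rule: rtranclp_induct)
  case base
  then show ?case by (auto intro!: eq_in_C.refl arr_lincomb_mor)
next
  case (step L' L'')
  then show ?case using simp_step_sound by (blast intro: eq_in_C.trans)
qed

section \<open>Diagrams as words of layers\<close>

text \<open>Recovers the right-hand strand counts from the target \<open>n\<close>, going down the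
  word; on valid words the differences are exact.\<close>

fun lay :: "nat \<Rightarrow> letter list \<Rightarrow> layer list" where
  "lay n [] = []"
| "lay n ((g, l) # w) = Layer l g (n - l - gcod g) # lay (n + gdom g - gcod g) w"

lemma lay_append [simp]: "lay n (x @ y) = lay n x @ lay (bottom n x) y"
  by (induction n x rule: lay.induct) auto

lemma is_diagram_lay: "is_diagram m n (lay n w) \<longleftrightarrow> valid n w \<and> bottom n w = m"
proof (induction n w rule: lay.induct)
  case (2 n g l w)
  have "l + gcod g \<le> n \<Longrightarrow> l + gdom g + (n - l - gcod g) = n + gdom g - gcod g" by simp
  then show ?case using 2 by auto
qed auto

lemma ex_lay: "is_diagram m n w \<Longrightarrow> \<exists>v. w = lay n v"
proof (induction w arbitrary: n)
  case Nil
  have "[] = lay n []" by simp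
  then show ?case by blast
next
  case (Cons x w)
  obtain l g r where x: "x = Layer l g r" by (cases x)
  have n: "n = l + gcod g + r" and "is_diagram m (l + gdom g + r) w" using Cons.prems x by auto
  then obtain v where "w = lay (l + gdom g + r) v" using Cons.IH by blast
  then have "x # w = lay n ((g, l) # v)" using n x by (simp add: ac_simps)
  then show ?case by blast
qed

text \<open>Each rule preserves or decreases both the length and the number of crossings of a diagram in
  every term; their sum is the induction measure.\<close>

fun layer_cost :: "layer \<Rightarrow> nat" where
  "layer_cost (Layer l g r) = (if g = Cross then 2 else 1)"

definition cost :: "layer list \<Rightarrow> nat" where
  "cost w = sum_list (map layer_cost w)"

lemma cost_simps [simp]:
  "cost [] = 0" "cost (x # w) = layer_cost x + cost w" "cost (v @ w) = cost v + cost w"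
  by (simp_all add: cost_def)

lemma cost_whisker [simp]: "cost (whisker l r w) = cost w"
  by (induction w) (auto simp: whisker_def split: layer.split)

lemma lead_cost: "lead u v \<Longrightarrow> cost (lay n v) = cost (lay n' u)"
  by (induction rule: lead.induct) auto

text \<open>The padding is \<open>l = i\<close> on the left and, since \<open>n\<close> counts
  strands at the top, \<open>n - i\<close> minus the target of the relation on the right.\<close>

lemma collapse_rule:
  assumes "collapses u" and "valid n u"
  shows "\<exists>l r w R. local_rule P w R \<and> lay n u = whisker l r w \<and> (\<forall>(c, z)\<in>set R. cost z < cost w)"
proof -
  have rel: ?thesis
    if "defrel P m k w R" "lay n u = whisker l r w" "\<forall>(c, z)\<in>set R. cost z < cost w" for m k w R l r
    using that local_rule.relation by blast
  from assms show ?thesis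
  proof cases
    case (untwist i)
    show ?thesis by (rule rel[OF defrel.untwist, of i "n - i - 2"]) (use untwist assms(2) in auto)
  next
    case (untwist' i)
    show ?thesis by (rule rel[OF defrel.untwist', of i "n - i"]) (use untwist' assms(2) in auto)
  next
    case (loop i)
    show ?thesis by (rule rel[OF defrel.loop, of i "n - i"]) (use loop assms(2) in auto)
  next
    case (straighten i)
    show ?thesis by (rule rel[OF defrel.straighten, of i "n - i - 1"]) (use straighten assms(2) in auto)
  next
    case (straighten' i)
    show ?thesis by (rule rel[OF defrel.straighten', of i "n - i - 1"]) (use straighten' assms(2) in auto)
  next
    case (deloop i)
    show ?thesis by (rule rel[OF defrel.deloop, of i "n - i - 1"]) (use deloop assms(2) in auto)
  next
    case (twist i)
    show ?thesis by (rule rel[OF defrel.twist, of i "n - i - 2"]) (use twist assms(2) in auto)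
  next
    case (pull i)
    show ?thesis by (rule rel[OF defrel.pull, of i "n - i - 3"]) (use pull assms(2) in auto)
  next
    case (pull' i)
    show ?thesis by (rule rel[OF defrel.pull', of i "n - i - 1"]) (use pull' assms(2) in auto)
  qed
qed

text \<open>Only the sliding relations have terms besides the leading one, and in these the crossing
  has disappeared.\<close>

lemma lead_rule:
  assumes "lead u u'" and "valid n u"
  shows "\<exists>l r w R w'. local_rule P w R \<and> lay n u = whisker l r w \<and> lay n u' = whisker l r w' \<and>
    (\<forall>(c, z)\<in>set R. z = w' \<or> cost z < cost w)"
proof -
  have rel: ?thesis
    if "local_rule P w R" "lay n u = whisker l r w" "lay n u' = whisker l r w'"
      "\<forall>(c, z)\<in>set R. z = w' \<or> cost z < cost w" for w R l r w'
    using that by blast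
  from assms show ?thesis
  proof cases
    case (swap i g j h)
    \<comment> \<open>Here \<open>k\<close> is the number of strands between the two
      generators.\<close>
    then obtain k where k: "j = i + gdom g + k" using le_Suc_ex by blast
    show ?thesis
      by (rule rel[OF local_rule.interchange[of P g k h], of i "n - i - gcod g - k - gcod h"
            "[Layer (gcod g + k) h 0, Layer 0 g (k + gdom h)]"])
        (use swap assms(2) k in auto)
  next
    case (swap_back i g j h)
    then obtain k where k: "j = i + gcod g + k" using le_Suc_ex by blast
    show ?thesis
      by (rule rel[OF local_rule.interchange_back[of P g k h], of i "n - i - gcod g - k - gcod h"
            "[Layer 0 g (k + gcod h), Layer (gdom g + k) h 0]"])
        (use swap_back assms(2) k in auto)
  next
    case (braid i)
    show ?thesis
      by (rule rel[OF local_rule.relation[OF defrel.braid], of i "n - i - 3"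
            "[Layer 1 Cross 0, Layer 0 Cross 1, Layer 1 Cross 0]"]) (use braid assms(2) in auto)
  next
    case (braid_back i)
    show ?thesis
      by (rule rel[OF local_rule.braid_back, of i "n - i - 3"
            "[Layer 0 Cross 1, Layer 1 Cross 0, Layer 0 Cross 1]"]) (use braid_back assms(2) in auto)
  next
    case (slide i)
    show ?thesis
      by (rule rel[OF local_rule.relation[OF defrel.slide], of i "n - i - 3"
            "[Layer 1 Cross 0, Layer 0 Cup 1]"]) (use slide assms(2) in auto)
  next
    case (slide' i)
    show ?thesis
      by (rule rel[OF local_rule.relation[OF defrel.slide'], of i "n - i - 1"
            "[Layer 0 Cap 1, Layer 1 Cross 0]"]) (use slide' assms(2) in auto)
  qed
qed

section \<open>Reduction of linear combinations\<close>

text \<open>A finite tree of steps below a single word. Branches are indexed by terms and ignore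
  coefficients, so one tree serves the word under every scalar.\<close>

inductive reduces_to :: "'k::field params \<Rightarrow> layer list set \<Rightarrow> layer list \<Rightarrow> bool" for P T where
  stop: "w \<in> T \<Longrightarrow> reduces_to P T w"
| step: "local_rule P w R \<Longrightarrow> (\<forall>(c, z)\<in>set R. reduces_to P T (x @ whisker l r z @ y)) \<Longrightarrow>
    reduces_to P T (x @ whisker l r w @ y)"

lemma simp_step_ctx: "simp_step P L M \<Longrightarrow> simp_step P (X @ L @ Y) (X @ M @ Y)"
proof (induction rule: simp_step.induct)
  case (1 w R L c x l r y L')
  then show ?case using simp_step.intros[of P w R "X @ L" c x l r y "L' @ Y"] by simp
qed

lemma simplifies_to_ctx: "simplifies_to P L M \<Longrightarrow> simplifies_to P (X @ L @ Y) (X @ M @ Y)"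
proof (induction rule: rtranclp_induct)
  case (step M N)
  show ?case by (rule rtranclp.rtrancl_into_rtrancl[OF step.IH simp_step_ctx[OF step.hyps(2)]])
qed simp

lemma simplifies_to_all:
  assumes "\<And>c w. (c, w) \<in> set L \<Longrightarrow> \<exists>M. simplifies_to P [(c, w)] M \<and> (\<forall>(b, v)\<in>set M. v \<in> T)"
  shows "\<exists>M. simplifies_to P L M \<and> (\<forall>(b, v)\<in>set M. v \<in> T)"
  using assms
proof (induction L)
  case (Cons a L)
  obtain c w where a: "a = (c, w)" by force
  obtain M where M: "simplifies_to P L M" "\<forall>(b, v)\<in>set M. v \<in> T"
    using Cons.IH Cons.prems by (metis list.set_intros(2))
  obtain N where N: "simplifies_to P [a] N" "\<forall>(b, v)\<in>set N. v \<in> T"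
    using Cons.prems[of c w] a by auto
  \<comment> \<open>Steps rewrite one summand and leave the others in place, so the words are
    treated one after another without collecting terms.\<close>
  have "simplifies_to P (a # L) (N @ L)" using simplifies_to_ctx[OF N(1), of "[]" L] by simp
  moreover have "simplifies_to P (N @ L) (N @ M)" using simplifies_to_ctx[OF M(1), of N "[]"] by simp
  ultimately show ?case using M(2) N(2) by (intro exI[of _ "N @ M"]) auto
qed (auto intro: exI[of _ "[]"])

lemma reduces_to_simplifies:
  "reduces_to P T w \<Longrightarrow> \<exists>M. simplifies_to P [(c, w)] M \<and> (\<forall>(b, v)\<in>set M. v \<in> T)"
proof (induction arbitrary: c rule: reduces_to.induct)
  case (stop w)
  then show ?case by (intro exI[of _ "[(c, w)]"]) auto
next
  case (step w R x l r y)
  let ?M = "map (\<lambda>(b, v). (c * b, x @ whisker l r v @ y)) R"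
  have "simp_step P [(c, x @ whisker l r w @ y)] ?M"
    using simp_step.intros[OF step.hyps, of "[]" c x l r y "[]"] by simp
  moreover obtain M where "simplifies_to P ?M M" "\<forall>(b, v)\<in>set M. v \<in> T"
  proof (rule exE[OF simplifies_to_all])
    fix b u assume "(b, u) \<in> set ?M"
    then obtain b' v where v: "(b', v) \<in> set R" "u = x @ whisker l r v @ y" by auto
    show "\<exists>M. simplifies_to P [(b, u)] M \<and> (\<forall>(b, v)\<in>set M. v \<in> T)"
      using bspec[OF step.IH v(1)] v(2) by simp
  qed blast
  ultimately show ?case using converse_rtranclp_into_rtranclp[of "simp_step P"] by blast
qed

text \<open>The last premise is the hypothesis of the induction on the weight. The derivation
  supplies the branch of the leading terms, along which the weight is constant; every other branch
  leads to a lighter diagram of the same type and is closed by that premise.\<close>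

lemma settles_reduces:
  assumes "settles (\<lambda>v. lay n v \<in> T) w" and "valid n w"
    and "\<And>w'. is_diagram (bottom n w) n w' \<Longrightarrow> cost w' < cost (lay n w) \<Longrightarrow> reduces_to P T w'"
  shows "reduces_to P T (lay n w)"
  using assms
proof (induction rule: settles.induct)
  case (stop w)
  then show ?case by (simp add: reduces_to.stop)
next
  case (step u v x y)
  have val: "valid (bottom n x) u" using step.prems(1) by simp
  obtain l r w R w' where w: "local_rule P w R" "lay (bottom n x) u = whisker l r w"
    "lay (bottom n x) v = whisker l r w'" "\<forall>(c, z)\<in>set R. z = w' \<or> cost z < cost w"
    using lead_rule[OF step.hyps(1) val] by blast
  have bottom: "bottom (bottom n x) v = bottom (bottom n x) u" "valid (bottom n x) v"
    using lead_valid[OF step.hyps(1) val] by auto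
  let ?y = "lay (bottom (bottom n x) u) y"
  have "reduces_to P T (lay n x @ whisker l r z @ ?y)" if z: "(c, z) \<in> set R" for c z
  proof (cases "z = w'")
    case True
    have "cost (lay n (x @ v @ y)) = cost (lay n (x @ u @ y))"
      using lead_cost[OF step.hyps(1), of "bottom n x" "bottom n x"] bottom by simp
    then have "reduces_to P T (lay n (x @ v @ y))"
      by (intro step.IH) (use step.prems bottom in auto)
    then show ?thesis using True w(3) bottom by simp
  next
    case False
    have D: "is_diagram (bottom n (x @ u @ y)) n (lay n x @ whisker l r w @ ?y)"
      using step.prems(1) is_diagram_lay[of "bottom n (x @ u @ y)" n "x @ u @ y"] w(2) by simp
    have "is_diagram (bottom n (x @ u @ y)) n (lay n x @ whisker l r z @ ?y)"
      using local_rule_context_sound[OF w(1) D] z by blast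
    moreover have "cost (lay n x @ whisker l r z @ ?y) < cost (lay n (x @ u @ y))"
      using w(2,4) z False by auto
    ultimately show ?thesis using step.prems(2) by blast
  qed
  then have "reduces_to P T (lay n x @ whisker l r w @ ?y)"
    by (intro reduces_to.step[OF w(1)]) blast
  then show ?case using w(2) by simp
next
  case (collapse u x y)
  have val: "valid (bottom n x) u" using collapse.prems(1) by simp
  obtain l r w R where w: "local_rule P w R" "lay (bottom n x) u = whisker l r w"
    "\<forall>(c, z)\<in>set R. cost z < cost w"
    using collapse_rule[OF collapse.hyps(1) val] by blast
  let ?y = "lay (bottom (bottom n x) u) y"
  have D: "is_diagram (bottom n (x @ u @ y)) n (lay n x @ whisker l r w @ ?y)"
    using collapse.prems(1) is_diagram_lay[of "bottom n (x @ u @ y)" n "x @ u @ y"] w(2) by simp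
  have "reduces_to P T (lay n x @ whisker l r z @ ?y)" if z: "(c, z) \<in> set R" for c z
  proof (rule collapse.prems(2))
    show "is_diagram (bottom n (x @ u @ y)) n (lay n x @ whisker l r z @ ?y)"
      using local_rule_context_sound[OF w(1) D] z by blast
    show "cost (lay n x @ whisker l r z @ ?y) < cost (lay n (x @ u @ y))"
      using w(2,3) z by auto
  qed
  then have "reduces_to P T (lay n x @ whisker l r w @ ?y)"
    by (intro reduces_to.step[OF w(1)]) blast
  then show ?case using w(2) by simp
qed

section \<open>Standard expressions\<close>

lemma valid_cross: "valid n (map S is) \<longleftrightarrow> (\<forall>i\<in>set is. i + 2 \<le> n)"
  by (induction "is") auto

lemma bottom_cross [simp]: "valid n (map S is) \<Longrightarrow> bottom n (map S is) = n"
  by (induction "is") auto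

lemma lay_cross: "lay n (map S is) = map (\<lambda>i. s_fd i n) (map Suc is)"
  by (induction "is") (auto simp: s_fd_def)

lemma lay_Iw:
  assumes "valid n (Iw p s)"
  shows "bottom n (Iw p s) = n - 2 \<and> lay n (Iw p s) = I_word s (n - 2) (p + 1)"
proof -
  have n: "p + s + 2 \<le> n" using assms by (rule valid_Iw)
  then have n2: "Suc (Suc (n - 2)) = n" by simp
  have "map Suc (rev [p + 1..<p + s + 1]) = rev [p + 1 + 1..<p + 1 + s + 1]"
    by (simp add: rev_map[symmetric] map_Suc_upt del: upt_Suc)
  moreover have "valid n (map S (rev [p + 1..<p + s + 1]))" using assms by (simp add: Iw_def)
  ultimately show ?thesis
    using n n2 by (simp add: Iw_def I_word_def lay_cross u_fd_def del: upt_Suc map_map)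
qed

lemma lay_Jw:
  assumes "valid n (Jw p s)"
  shows "bottom n (Jw p s) = n + 2 \<and> lay n (Jw p s) = J_word s n (p + 1) \<and> p + s \<le> n"
proof -
  have "map Suc [p + 1..<p + s + 1] = [p + 1 + 1..<p + 1 + s + 1]"
    by (simp add: map_Suc_upt del: upt_Suc)
  moreover have v: "valid (n + 2) (map S [p + 1..<p + s + 1])" "p \<le> n" using assms by (simp_all add: Jw_def)
  moreover have "p + s \<le> n" using v by (cases s) (auto simp: valid_cross)
  ultimately show ?thesis
    by (simp add: Jw_def J_word_def lay_cross a_fd_def del: upt_Suc map_map)
qed

text \<open>The entries of \<open>ps\<close> provide the functions \<open>p\<close> and
  \<open>s\<close> of \<open>I_set\<close>, shifted to positions from 1. The bound required there
  says that the right end of each cup lies within the strands at its top, which is what validity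
  gives.\<close>

lemma lay_Is:
  "valid n (Is ps) \<Longrightarrow> 2 * length ps \<le> n \<and> bottom n (Is ps) = n - 2 * length ps \<and>
    lay n (Is ps) =
      concat (map (\<lambda>j. I_word (snd (ps ! j)) (n - 2 * (j + 1)) (fst (ps ! j) + 1)) [0..<length ps]) \<and>
    (\<forall>j<length ps. fst (ps ! j) + 1 + snd (ps ! j) \<le> n - 2 * (j + 1) + 1)"
proof (induction ps arbitrary: n)
  case (Cons a ps)
  obtain p s where a: "a = (p, s)" by force
  have v: "valid n (Iw p s)" "valid (n - 2) (Is ps)" using Cons.prems a lay_Iw[of n p s] by auto
  note IH = Cons.IH[OF v(2)] and L = lay_Iw[OF v(1)] and n = valid_Iw[OF v(1)]
  have eq: "[0..<length (a # ps)] = 0 # map Suc [0..<length ps]"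
    by (simp add: map_Suc_upt upt_conv_Cons del: upt_Suc)
  have "lay n (Is (a # ps)) = concat (map (\<lambda>j. I_word (snd ((a # ps) ! j)) (n - 2 * (j + 1))
      (fst ((a # ps) ! j) + 1)) [0..<length (a # ps)])"
    unfolding eq using a IH L by (simp add: comp_def numeral_2_eq_2)
  moreover have "fst ((a # ps) ! j) + 1 + snd ((a # ps) ! j) \<le> n - 2 * (j + 1) + 1"
    if "j < length (a # ps)" for j
    using that IH n a by (cases j) (auto simp: diff_diff_left)
  moreover have "2 * length (a # ps) \<le> n" 
    using add_le_mono1[OF IH[THEN conjunct1], of 2] n by simp
  ultimately show ?case using IH L a by simp
qed simp

lemma lay_Js:
  "valid n (Js ps) \<Longrightarrow> bottom n (Js ps) = n + 2 * length ps \<and>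
    lay n (Js ps) =
      concat (map (\<lambda>j. J_word (snd (ps ! j)) (n + 2 * j) (fst (ps ! j) + 1)) [0..<length ps]) \<and>
    (\<forall>j<length ps. fst (ps ! j) + 1 + snd (ps ! j) \<le> n + 2 * j + 1)"
proof (induction ps arbitrary: n)
  case Nil
  then show ?case by (simp add: Js_def)
next
  case (Cons a ps)
  obtain p s where a: "a = (p, s)" by force
  have J: "Js (a # ps) = Jw p s @ Js ps" using a by (simp add: Js_def)
  have v: "valid n (Jw p s)" "valid (n + 2) (Js ps)" using Cons.prems J lay_Jw[of n p s] by auto
  note IH = Cons.IH[OF v(2)] and L = lay_Jw[OF v(1)]
  have eq: "[0..<length (a # ps)] = 0 # map Suc [0..<length ps]"
    by (simp add: map_Suc_upt upt_conv_Cons del: upt_Suc)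
  have "lay n (Js (a # ps)) = concat (map (\<lambda>j. J_word (snd ((a # ps) ! j)) (n + 2 * j)
      (fst ((a # ps) ! j) + 1)) [0..<length (a # ps)])"
    unfolding eq using a IH L J by (simp add: comp_def add.assoc)
  moreover have "fst ((a # ps) ! j) + 1 + snd ((a # ps) ! j) \<le> n + 2 * j + 1"
    if "j < length (a # ps)" for j
    using that IH L a by (cases j) auto
  ultimately show ?case using IH L J by simp
qed

lemma lay_standard:
  assumes v: "valid n v" "v = Is ps @ map S is @ Js qs" "sortedI ps" "sortedJ qs"
    and X: "map Suc is \<in> HH (n - 2 * length ps)"
  shows "lay n v \<in> standard HH (bottom n v) n"
proof -
  let ?r = "n - 2 * length ps"
  have val: "valid n (Is ps)" using v by simp
  note I = lay_Is[OF val]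
  have valX: "valid ?r (map S is)" and valJ: "valid ?r (Js qs)" using v I by auto
  note J = lay_Js[OF valJ]
  have "lay n (Is ps) \<in> I_set ?r n"
    unfolding I_set_def
    using I v(3) by (intro CollectI exI[of _ "length ps"] exI[of _ "\<lambda>j. snd (ps ! j)"]
      exI[of _ "\<lambda>j. fst (ps ! j) + 1"]) (auto simp: sorted_wrt_iff_nth_less)
  moreover have "lay ?r (Js qs) \<in> J_set (?r + 2 * length qs) ?r"
    unfolding J_set_def
    using J v(4) by (intro CollectI exI[of _ "length qs"] exI[of _ "\<lambda>j. snd (qs ! j)"]
      exI[of _ "\<lambda>j. fst (qs ! j) + 1"]) (auto simp: sorted_wrt_iff_nth_less)
  moreover have "bottom n v = ?r + 2 * length qs" using v(2) I J valX by simp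
  moreover have "lay n v = lay n (Is ps) @ map (\<lambda>i. s_fd i ?r) (map Suc is) @ lay ?r (Js qs)"
    using v(2) I valX by (simp add: lay_cross del: map_map)
  ultimately show ?thesis
    unfolding standard_def using X
    by (intro CollectI exI[of _ "lay n (Is ps)"] exI[of _ ?r] exI[of _ "map Suc is"]
        exI[of _ "lay ?r (Js qs)"] conjI) (simp_all only:)
qed

text \<open>Words of the symmetric group count from 1 and letters from 0; \<open>is_word\<close>
  makes every index positive, so \<open>i - 1\<close> is not truncated.\<close>

lemma braid_eq_leads:
  "braid_eq u v \<Longrightarrow> is_word r u \<Longrightarrow> leads (map (\<lambda>i. S (i - 1)) u) (map (\<lambda>i. S (i - 1)) v)"
proof (induction rule: braid_eq.induct)
  case (step u v x y w)
  have pos: "\<forall>i\<in>set u. 1 \<le> i" using step.prems by (auto simp: is_word_def)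
  have "lead (map (\<lambda>i. S (i - 1)) u) (map (\<lambda>i. S (i - 1)) v)"
    using step.hyps(1) pos
  proof cases
    case (commute i j)
    then show ?thesis using lead.swap[of "i - 1" Cross "j - 1" Cross] pos by (auto simp: le_diff_conv2)
  next
    case (commute_back i j)
    then show ?thesis using lead.swap_back[of "i - 1" Cross "j - 1" Cross] pos by (auto simp: le_diff_conv2)
  next
    case (braid i)
    then show ?thesis using lead.braid[of "i - 1"] pos by simp
  next
    case (braid_back i)
    then show ?thesis using lead.braid_back[of "i - 1"] pos by simp
  qed
  then have "leads (map (\<lambda>i. S (i - 1)) (x @ u @ y)) (map (\<lambda>i. S (i - 1)) (x @ v @ y))"
    using leads_ctx[OF lead_leads] by simp
  moreover have "is_word r (x @ v @ y)"
    using braid_eq_is_word[OF braid_move_eq[OF step.hyps(1)]] step.prems by blast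
  ultimately show ?case using step.IH leads_trans by blast
qed simp

lemma settles_standard:
  assumes "admissible_H HH" and "valid n w"
  shows "settles (\<lambda>v. lay n v \<in> standard HH (bottom n w) n) w" (is "settles ?T w")
proof (rule settles_bind[OF settles_valid[OF settles_IXJ[OF assms(2)] assms(2)]])
  fix v assume "(\<exists>ps is qs. v = Is ps @ map S is @ Js qs \<and> sortedI ps \<and> sortedJ qs) \<and>
    valid n v \<and> bottom n v = bottom n w"
  then obtain ps "is" qs where v: "v = Is ps @ map S is @ Js qs" "sortedI ps" "sortedJ qs"
    "valid n v" "bottom n v = bottom n w" by blast
  let ?r = "n - 2 * length ps"
  have valI: "valid n (Is ps)" using v by simp
  note I = lay_Is[OF valI]
  have "valid ?r (map S is)" using v(1,4) I by simp
  then have word: "is_word ?r (map Suc is)"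
  proof (induction "is")
    case (Cons i "is")
    then show ?case by (auto simp: is_word_def)
  qed (simp add: is_word_def)
  obtain X where X: "braid_eq (map Suc is) X" "X \<in> HH ?r \<or> (\<exists>x j y. X = x @ [j, j] @ y)"
    using matsumoto[OF assms(1) word] by blast
  let ?X = "map S (map (\<lambda>i. i - 1) X)"
  have "leads (map S is) ?X" using braid_eq_leads[OF X(1) word] by (simp add: comp_def)
  then have leads: "leads v (Is ps @ ?X @ Js qs)" using leads_ctx v(1) by blast
  \<comment> \<open>Membership in the standard set needs the type of the word that is reached, which
    is not yet at hand. It is kept as a premise of the target and discharged by
    \<open>settles_valid\<close> afterwards.\<close>
  from X(2) have "settles (\<lambda>v. valid n v \<and> bottom n v = bottom n w \<longrightarrow> ?T v) (Is ps @ ?X @ Js qs)"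
  proof
    assume H: "X \<in> HH ?r"
    have "map Suc (map (\<lambda>i. i - 1) X) = X"
      using word braid_eq_is_word[OF X(1), of ?r] by (auto simp: is_word_def intro!: map_idI)
    with H have "map Suc (map (\<lambda>i. i - 1) X) \<in> HH ?r" by simp
    note lay_standard[of n "Is ps @ ?X @ Js qs" ps "map (\<lambda>i. i - 1) X" qs HH, OF _ HOL.refl v(2,3) this]
    then show ?thesis by (intro settles.stop impI) metis
  next
    assume "\<exists>x j y. X = x @ [j, j] @ y"
    then obtain x j y where "X = x @ [j, j] @ y" by blast
    then show ?thesis
      using settles.collapse[OF collapses.twist[of "j - 1"], of _ "Is ps @ map S (map (\<lambda>i. i - 1) x)"
          "map S (map (\<lambda>i. i - 1) y) @ Js qs"] by simp
  qed
  from settles_valid[OF leads_settles[OF leads this] v(4)] show "settles ?T v"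
    by (rule settles_bind) (use v(5) in \<open>auto intro: settles.stop\<close>)
qed

lemma reduces_to_standard:
  assumes "admissible_H HH"
  shows "is_diagram m n w \<Longrightarrow> reduces_to P (standard HH m n) w"
proof (induction "cost w" arbitrary: w rule: less_induct)
  case less
  obtain v where v: "w = lay n v" using ex_lay[OF less.prems] by blast
  then have "valid n v" "bottom n v = m" using less.prems is_diagram_lay by auto
  then show ?case
    using settles_reduces[OF settles_standard[OF assms], of n v P] less.hyps v by auto
qed

theorem theorem5p1:
  fixes P :: "'k::field params"
    and HH :: "nat \<Rightarrow> nat list set"
    and w :: "layer list"
    and m n :: nat
  assumes "(2::'k) \<noteq> 0"
    and "admissible_H HH"
    and "is_diagram m n w"
  shows "\<forall>L. simplifies_to P [(1, w)] L \<longrightarrow>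
           (\<exists>L'. simplifies_to P L L' \<and>
                 (\<forall>(c, v)\<in>set L'. v \<in> standard HH m n) \<and>
                 eq_in_C P m n (diagram_mor m w) (lincomb_mor m n L'))"
proof (intro allI impI)
  fix L assume L: "simplifies_to P [(1, w)] L"
  have w: "diagrams m n [(1, w)]" using assms(3) by simp
  \<comment> \<open>Simplification preserves types, so every word of an arbitrary intermediate
    \<open>L\<close> can be reduced afresh: no earlier choice of steps leads to a dead end.\<close>
  have dL: "diagrams m n L" using simplifies_to_sound[OF L w] by blast
  have "\<exists>M. simplifies_to P L M \<and> (\<forall>(b, v)\<in>set M. v \<in> standard HH m n)"
  proof (rule simplifies_to_all)
    fix c v assume "(c, v) \<in> set L"
    then have "is_diagram m n v" using dL by blast
    then show "\<exists>M. simplifies_to P [(c, v)] M \<and> (\<forall>(b, v)\<in>set M. v \<in> standard HH m n)"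
      by (intro reduces_to_simplifies reduces_to_standard assms(2))
  qed
  then obtain M where M: "simplifies_to P L M" "\<forall>(b, v)\<in>set M. v \<in> standard HH m n" by blast
  have "eq_in_C P m n (diagram_mor m w) (lincomb_mor m n [(1, w)])"
    using eq_in_C.sym[OF Scale_1_Zero[OF arr_diagram_mor[OF assms(3)]]] by simp
  also have "eq_in_C P m n \<dots> (lincomb_mor m n M)"
    using simplifies_to_sound[OF rtranclp_trans[OF L M(1)] w] by blast
  finally show "\<exists>L'. simplifies_to P L L' \<and> (\<forall>(c, v)\<in>set L'. v \<in> standard HH m n) \<and>
      eq_in_C P m n (diagram_mor m w) (lincomb_mor m n L')"
    using M by blast
qed

end
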